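(* Let $\langle\mathcal S,\mathcal A,\mathcal P,\mathcal R,\gamma\rangle$ be a discounted Markov decision process with $\gamma\in(0,1)$, let $\alpha>0$, $\epsilon>0$, and let $\pi$ be a stationary policy. Assume: (a) for each $s\in\mathcal S$, if $a\sim\pi(\cdot\mid s)$, then $\log\pi(a\mid s)$ is well defined almost surely; (b) $\sup_{(s,a)\in\mathcal S\times\mathcal A}\mathbb E_{r\sim R(s,a),\,(s',a')\sim\mathcal P^\pi(\cdot\mid s,a)}\bigl[|r-\gamma\alpha\log\pi(a'\mid s')|\bigr]<\infty$; (c) for every $F\in\mathcal X^{\mathrm{cdf}}$ and $x\in\mathbb R$, the map $(s,a)\mapsto\mathbb E_{r\sim R(s,a),\,(s',a')\sim\mathcal P^\pi(\cdot\mid s,a)}\bigl[F(s',a')\bigl(\tfrac{x-r}{\gamma}+\alpha\log\pi(a'\mid s')\bigr)\bigr]$ is measurable; (d) the CDF field of the policy-induced soft return-distribution field $\mathcal Z^\pi$ satisfies $F_{\mathcal Z^\pi}\in\mathcal X^{\mathrm{cdf}}$ (so that $F_{\mathcal Z^\pi}$ is the unique fixed point of $\mathcal T^\pi_{\mathrm{cdf}}$ in $\mathcal X^{\mathrm{cdf}}$). Let $\mathcal T^\pi:=\mathbb V\,\mathcal T^\pi_{\mathrm{cdf}}\,\mathbb V^{-1}$ on $\mathcal X^{\mathrm{adm}}$. Let $F_0\in\mathcal X^{\mathrm{cdf}}$, $F_{k+1}=\mathcal T^\pi_{\mathrm{cdf}}F_k$ and $\nu_k:=\mathbb VF_k$ for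 $k\ge0$. Then $\nu_{k+1}=\mathcal T^\pi\nu_k$ for every $k\ge0$. Moreover, with $\nu^\pi:=\mathbb VF_{\mathcal Z^\pi}$, one has $\nu_k\to\nu^\pi$ in the induced metric $\widetilde d_{\mathrm{Cr}}$.
   Context: MDP: $\mathcal S,\mathcal A$ are measurable spaces (states, actions), $\mathcal P(\cdot\mid s,a)$ is a transition kernel on $\mathcal S$, $\mathcal R:\mathcal S\times\mathcal A\times\mathcal S\to\mathbb R$ is a (measurable) reward function. A stationary policy $\pi$ assigns to each $s$ a probability distribution $\pi(\cdot\mid s)$ on $\mathcal A$; $\pi(a\mid s)$ denotes the value of its probability mass function / density. Sampling: $(s',a')\sim\mathcal P^\pi(\cdot\mid s,a)$ means $s'\sim\mathcal P(\cdot\mid s,a)$ and then $a'\sim\pi(\cdot\mid s')$; $r\sim R(s,a)$ denotes the one-step reward $r=\mathcal R(s,a,s')$ generated by the same next state $s'$. Soft return: for the trajectory with $S_{t+1}\sim\mathcal P(\cdot\mid S_t,A_t)$, $R_t=\mathcal R(S_t,A_t,S_{t+1})$ and subsequent actions drawn from $\pi$, $Z^\pi(s,a)$ is $Z_t^\pi:=R_t+\sum_{k\ge1}\gamma^k[R_{t+k}-\alpha\log\pi(A_{t+k}\mid S_{t+k})]$ (series assumed almost surely convergent) conditioned on $(S_t,A_t)=(s,a)$; its law does not depend on $t$. Put $\mathcal Z^\pi(s,a):=\mathrm{Law}(Z^\pi(s,a))$, and let $F_{\mathcal Z^\pi}(s,a)$ be the CDF of $\mathcal Z^\pi(s,a)$.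 It satisfies the Bellman equation $Z^\pi(s,a)=R(s,a)+\gamma(Z^\pi(s',a')-\alpha\log\pi(a'\mid s'))$ in law, with $(s',a')\sim\mathcal P^\pi(\cdot\mid s,a)$ and $R(s,a)$ the one-step reward. CDF domain: $\Gamma_F$ is the set of CDFs $F$ on $\mathbb R$ with $\int_{\mathbb R}(F(x)-\mathbf 1\{x\ge0\})^2dx<\infty$. $\mathcal X^{\mathrm{cdf}}$ is the set of all CDF fields $F:(s,a)\mapsto F(s,a)\in\Gamma_F$ (with $(s,a)\mapsto F(s,a)(x)$ measurable for each $x\in\mathbb R$) such that $\sup_{(s,a)}\int_{\mathbb R}(F(s,a)(x)-\mathbf 1\{x\ge0\})^2dx<\infty$. Metric: $d_{\mathrm{Cr}}(F_1,F_2):=\sup_{(s,a)}\bigl(\int_{\mathbb R}(F_1(s,a)(x)-F_2(s,a)(x))^2dx\bigr)^{1/2}$. Operator: for $F\in\mathcal X^{\mathrm{cdf}}$, $(\mathcal T^\pi_{\mathrm{cdf}}F)(s,a)(x):=\mathbb E_{r\sim R(s,a),\,(s',a')\sim\mathcal P^\pi(\cdot\mid s,a)}\bigl[F(s',a')\bigl(\tfrac{x-r}{\gamma}+\alpha\log\pi(a'\mid s')\bigr)\bigr]$. Spectral transport: $\widehat f(\omega)=\frac1{\sqrt{2\pi}}\int f(x)e^{-i\omega x}dx$ is the unitary Fourier transform. For fixed $\epsilon>0$, $\mathcal H^{\mathrm{cdf}}_\epsilon=\{H:\int\frac{\omega^2}{\omega^2+\epsilon}|\widehat H(\omega)|^2d\omega<\infty\}$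 and $\mathcal H_\epsilon=\{f:\|f\|^2_{\mathcal H_\epsilon}=\frac1{2\pi}\int\frac{|\widehat f(\omega)|^2}{\omega^2+\epsilon}d\omega<\infty\}$ (elements understood through their Fourier transforms). Centring: $C(F)=F-\mathbf 1\{\cdot\ge0\}$. $\mathcal U:\mathcal H^{\mathrm{cdf}}_\epsilon\to\mathcal H_\epsilon$ is defined by $\widehat{\mathcal UH}(\omega)=-\sqrt{2\pi}\,i\omega\,\overline{\widehat H(\omega)}$. $\mathcal V:=\mathcal U\circ C:\Gamma_F\to\mathcal H_\epsilon$, which is injective. For $F\in\mathcal X^{\mathrm{cdf}}$, $(\mathbb VF)(s,a):=\mathcal V(F(s,a))$. $\mathcal X^{\mathrm{adm}}:=\mathrm{range}(\mathbb V)$, so $\mathbb V:\mathcal X^{\mathrm{cdf}}\to\mathcal X^{\mathrm{adm}}$ is bijective with inverse given by pointwise $\mathcal V^{-1}$. Induced metric on $\mathcal X^{\mathrm{adm}}$: $\widetilde d_{\mathrm{Cr}}(\nu_1,\nu_2):=d_{\mathrm{Cr}}(\mathbb V^{-1}\nu_1,\mathbb V^{-1}\nu_2)$. *)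

theory Defs
  imports "HOL-Probability.Probability"
begin

section \<open>Markov decision processes and policies\<close>

text \<open>The state and action spaces are measurable spaces; they are given as measures of which only
  the underlying space and sigma-algebra are used.\<close>

record ('s, 'a) mdp =
  states :: "'s measure"
  actions :: "'a measure"
  trans_prob :: "'s \<Rightarrow> 'a \<Rightarrow> 's measure"
  reward :: "'s \<Rightarrow> 'a \<Rightarrow> 's \<Rightarrow> real"
  discount :: real

text \<open>The number \<open>pdens \<pi> s a\<close> is the value of the mass function or density at the action \<open>a\<close>; the
  density is taken with respect to \<open>ref_measure \<pi>\<close> (counting measure for a mass function). The
  reference measure is not required to be sigma-finite.\<close>

record ('s, 'a) policy =
  ref_measure :: "'a measure"
  pdens :: "'s \<Rightarrow> 'a \<Rightarrow> real"

abbreviation sa_space :: "('s, 'a) mdp \<Rightarrow> ('s \<times> 'a) measure" where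
  "sa_space M \<equiv> states M \<Otimes>\<^sub>M actions M"

definition is_discounted_mdp :: "('s, 'a) mdp \<Rightarrow> bool" where
  "is_discounted_mdp M \<longleftrightarrow>
     (\<lambda>(s, a). trans_prob M s a) \<in> sa_space M \<rightarrow>\<^sub>M prob_algebra (states M) \<and>
     (\<lambda>((s, a), s'). reward M s a s') \<in> borel_measurable (sa_space M \<Otimes>\<^sub>M states M) \<and>
     0 < discount M \<and> discount M < 1"

definition action_dist :: "('s, 'a) policy \<Rightarrow> 's \<Rightarrow> 'a measure" where
  "action_dist \<pi> s = density (ref_measure \<pi>) (\<lambda>a. ennreal (pdens \<pi> s a))"

definition is_stationary_policy :: "('s, 'a) mdp \<Rightarrow> ('s, 'a) policy \<Rightarrow> bool" where
  "is_stationary_policy M \<pi> \<longleftrightarrow>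
     sets (ref_measure \<pi>) = sets (actions M) \<and>
     (\<lambda>(s, a). pdens \<pi> s a) \<in> borel_measurable (sa_space M) \<and>
     (\<forall>s\<in>space (states M). \<forall>a\<in>space (actions M). 0 \<le> pdens \<pi> s a) \<and>
     action_dist \<pi> \<in> states M \<rightarrow>\<^sub>M prob_algebra (actions M)"

definition sa_kernel :: "('s, 'a) mdp \<Rightarrow> ('s, 'a) policy \<Rightarrow> 's \<times> 'a \<Rightarrow> ('s \<times> 'a) measure" where
  "sa_kernel M \<pi> = (\<lambda>(s, a).
     trans_prob M s a \<bind> (\<lambda>s'. action_dist \<pi> s' \<bind> (\<lambda>a'. return (sa_space M) (s', a'))))"

lemma measurable_sa_kernel:
  assumes "is_discounted_mdp M" and "is_stationary_policy M \<pi>"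
  shows "sa_kernel M \<pi> \<in> sa_space M \<rightarrow>\<^sub>M prob_algebra (sa_space M)"
proof -
  have t: "(\<lambda>z. trans_prob M (fst z) (snd z)) \<in> sa_space M \<rightarrow>\<^sub>M prob_algebra (states M)"
    using assms(1) by (simp add: is_discounted_mdp_def case_prod_beta')
  have [measurable]: "action_dist \<pi> \<in> states M \<rightarrow>\<^sub>M prob_algebra (actions M)"
    using assms(2) by (simp add: is_stationary_policy_def)
  show ?thesis
    unfolding sa_kernel_def case_prod_beta
    by (rule measurable_bind_prob_space2[where N="states M"])
       (rule t, unfold case_prod_beta', rule measurable_bind_prob_space2[where N="actions M"], measurable)
qed


section \<open>The soft return\<close>

text \<open>Conditioning a trajectory on its first state-action pair being \<open>z\<close> means using the law of the
  chain started in \<open>z\<close>. This law on sequences of state-action pairs is the Ionescu-Tulcea measure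
  whose coordinate 0 is the point mass at \<open>z\<close> and whose later coordinates are drawn from the
  kernel applied to the previous coordinate.\<close>

definition traj_kernel ::
  "('s, 'a) mdp \<Rightarrow> ('s, 'a) policy \<Rightarrow> 's \<times> 'a \<Rightarrow> nat \<Rightarrow> (nat \<Rightarrow> 's \<times> 'a) \<Rightarrow> ('s \<times> 'a) measure" where
  "traj_kernel M \<pi> z n \<omega> =
     (case n of 0 \<Rightarrow> return (sa_space M) z | Suc m \<Rightarrow> sa_kernel M \<pi> (\<omega> m))"

lemma Ionescu_Tulcea_traj_kernel:
  assumes "is_discounted_mdp M" and "is_stationary_policy M \<pi>" and z: "z \<in> space (sa_space M)"
  shows "Ionescu_Tulcea (traj_kernel M \<pi> z) (\<lambda>_. sa_space M)"
proof -
  have k[measurable]: "traj_kernel M \<pi> z n \<in> PiM {0..<n} (\<lambda>_. sa_space M) \<rightarrow>\<^sub>M prob_algebra (sa_space M)" for n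
  proof (cases n)
    case 0
    then show ?thesis
      using z by (auto simp: traj_kernel_def[abs_def] space_prob_algebra prob_space_return)
  next
    case (Suc m)
    have "(\<lambda>\<omega>. sa_kernel M \<pi> (\<omega> m)) \<in> PiM {0..<n} (\<lambda>_. sa_space M) \<rightarrow>\<^sub>M prob_algebra (sa_space M)"
      by (rule measurable_compose[OF _ measurable_sa_kernel[OF assms(1,2)]])
         (rule measurable_component_singleton, simp add: Suc)
    then show ?thesis
      by (simp add: Suc traj_kernel_def[abs_def])
  qed
  show ?thesis
  proof (rule Ionescu_Tulcea.intro)
    show "traj_kernel M \<pi> z n \<in> PiM {0..<n} (\<lambda>_. sa_space M) \<rightarrow>\<^sub>M subprob_algebra (sa_space M)" for n
      using k by (rule measurable_prob_algebraD)
    show "prob_space (traj_kernel M \<pi> z n \<omega>)" if "\<omega> \<in> space (PiM {0..<n} (\<lambda>_. sa_space M))" for n \<omega>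
      using measurable_space[OF k that] by (simp add: space_prob_algebra)
  qed
qed

definition traj_law ::
  "('s, 'a) mdp \<Rightarrow> ('s, 'a) policy \<Rightarrow> 's \<times> 'a \<Rightarrow> (nat \<Rightarrow> 's \<times> 'a) measure" where
  "traj_law M \<pi> z =
     projective_family.lim UNIV
       (Ionescu_Tulcea.CI (traj_kernel M \<pi> z) (\<lambda>_. sa_space M)) (\<lambda>_. sa_space M)"

lemma prob_space_traj_law:
  assumes "is_discounted_mdp M" and "is_stationary_policy M \<pi>" and "z \<in> space (sa_space M)"
  shows "prob_space (traj_law M \<pi> z)"
proof -
  interpret IT: Ionescu_Tulcea "traj_kernel M \<pi> z" "\<lambda>_. sa_space M"
    by (rule Ionescu_Tulcea_traj_kernel[OF assms])
  have "prob_space (distr IT.PF.lim (PiM {} (\<lambda>_. sa_space M)) (\<lambda>x. restrict x {}))"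
    by (simp add: IT.distr_lim IT.PF.prob_space_P)
  then show ?thesis
    unfolding traj_law_def
    by (rule prob_space_distrD[rotated]) (simp add: measurable_cong_sets[OF IT.PF.sets_lim])
qed

definition traj_reward :: "('s, 'a) mdp \<Rightarrow> (nat \<Rightarrow> 's \<times> 'a) \<Rightarrow> nat \<Rightarrow> real" where
  "traj_reward M \<omega> t = reward M (fst (\<omega> t)) (snd (\<omega> t)) (fst (\<omega> (Suc t)))"

definition soft_return_term ::
  "('s, 'a) mdp \<Rightarrow> ('s, 'a) policy \<Rightarrow> real \<Rightarrow> (nat \<Rightarrow> 's \<times> 'a) \<Rightarrow> nat \<Rightarrow> real" where
  "soft_return_term M \<pi> \<alpha> \<omega> k =
     discount M ^ k * (traj_reward M \<omega> k - \<alpha> * ln (pdens \<pi> (fst (\<omega> k)) (snd (\<omega> k))))"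

definition soft_return_converges :: "('s, 'a) mdp \<Rightarrow> ('s, 'a) policy \<Rightarrow> real \<Rightarrow> bool" where
  "soft_return_converges M \<pi> \<alpha> \<longleftrightarrow>
     (\<forall>z\<in>space (sa_space M). AE \<omega> in traj_law M \<pi> z.
        summable (\<lambda>k. soft_return_term M \<pi> \<alpha> \<omega> (Suc k)))"

definition soft_return :: "('s, 'a) mdp \<Rightarrow> ('s, 'a) policy \<Rightarrow> real \<Rightarrow> (nat \<Rightarrow> 's \<times> 'a) \<Rightarrow> real" where
  "soft_return M \<pi> \<alpha> \<omega> = traj_reward M \<omega> 0 + (\<Sum>k. soft_return_term M \<pi> \<alpha> \<omega> (Suc k))"

definition return_law ::
  "('s, 'a) mdp \<Rightarrow> ('s, 'a) policy \<Rightarrow> real \<Rightarrow> 's \<times> 'a \<Rightarrow> real measure" where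
  "return_law M \<pi> \<alpha> z = distr (traj_law M \<pi> z) borel (soft_return M \<pi> \<alpha>)"

text \<open>Fields on the state-action space are extensional functions, so that equality of fields means
  equality on the state-action space.\<close>

definition return_cdf ::
  "('s, 'a) mdp \<Rightarrow> ('s, 'a) policy \<Rightarrow> real \<Rightarrow> 's \<times> 'a \<Rightarrow> real \<Rightarrow> real" where
  "return_cdf M \<pi> \<alpha> = (\<lambda>z\<in>space (sa_space M). cdf (return_law M \<pi> \<alpha> z))"


section \<open>CDF fields, Cramer metric and the soft Bellman operator\<close>

definition centre :: "(real \<Rightarrow> real) \<Rightarrow> real \<Rightarrow> real" where
  "centre F x = F x - indicator {0..} x"

definition Gamma_F :: "(real \<Rightarrow> real) set" where
  "Gamma_F = {F. (\<exists>N. real_distribution N \<and> F = cdf N) \<and>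
                 (\<integral>\<^sup>+x. ennreal ((centre F x)\<^sup>2) \<partial>lborel) < \<infinity>}"

definition X_cdf :: "('s, 'a) mdp \<Rightarrow> ('s \<times> 'a \<Rightarrow> real \<Rightarrow> real) set" where
  "X_cdf M = {F \<in> space (sa_space M) \<rightarrow>\<^sub>E Gamma_F.
     (\<forall>x. (\<lambda>z. F z x) \<in> borel_measurable (sa_space M)) \<and>
     (\<Squnion>z\<in>space (sa_space M). \<integral>\<^sup>+x. ennreal ((centre (F z) x)\<^sup>2) \<partial>lborel) < \<infinity>}"

definition sqrt_ennreal :: "ennreal \<Rightarrow> ennreal" where
  "sqrt_ennreal c = (if c = \<infinity> then \<infinity> else ennreal (sqrt (enn2real c)))"

text \<open>The distance takes values in the extended nonnegative reals, so that its supremum makes sense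
  without side conditions; on \<open>X_cdf\<close> it is finite.\<close>

definition d_Cr ::
  "('s, 'a) mdp \<Rightarrow> ('s \<times> 'a \<Rightarrow> real \<Rightarrow> real) \<Rightarrow> ('s \<times> 'a \<Rightarrow> real \<Rightarrow> real) \<Rightarrow> ennreal" where
  "d_Cr M F G =
     (\<Squnion>z\<in>space (sa_space M). sqrt_ennreal (\<integral>\<^sup>+x. ennreal ((F z x - G z x)\<^sup>2) \<partial>lborel))"

definition T_cdf ::
  "('s, 'a) mdp \<Rightarrow> ('s, 'a) policy \<Rightarrow> real \<Rightarrow> ('s \<times> 'a \<Rightarrow> real \<Rightarrow> real) \<Rightarrow> 's \<times> 'a \<Rightarrow> real \<Rightarrow> real" where
  "T_cdf M \<pi> \<alpha> F = (\<lambda>(s, a)\<in>space (sa_space M). \<lambda>x.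
     \<integral>(s', a'). F (s', a') ((x - reward M s a s') / discount M + \<alpha> * ln (pdens \<pi> s' a'))
       \<partial>sa_kernel M \<pi> (s, a))"


section \<open>Spectral transport\<close>

text \<open>Square-integrable functions need not be integrable, so the unitary Fourier transform is the
  limit in the mean of the transforms of the truncations to \<open>[-T, T]\<close>. Its value is the set of all
  representatives, that is, an equivalence class modulo almost everywhere equality.\<close>

definition L2_fun :: "(real \<Rightarrow> complex) set" where
  "L2_fun = {f \<in> borel_measurable borel. (\<integral>\<^sup>+x. ennreal ((cmod (f x))\<^sup>2) \<partial>lborel) < \<infinity>}"

definition trunc_fourier :: "real \<Rightarrow> (real \<Rightarrow> complex) \<Rightarrow> real \<Rightarrow> complex" where
  "trunc_fourier T f \<omega> =
     (1 / sqrt (2 * pi)) *\<^sub>R (LINT x:{- T..T}|lborel. f x * exp (- \<i> * of_real (\<omega> * x)))"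

definition L2_fourier :: "(real \<Rightarrow> complex) \<Rightarrow> (real \<Rightarrow> complex) set" where
  "L2_fourier f = {g. f \<in> L2_fun \<and> g \<in> L2_fun \<and>
     ((\<lambda>T. \<integral>\<^sup>+\<omega>. ennreal ((cmod (g \<omega> - trunc_fourier T f \<omega>))\<^sup>2) \<partial>lborel) \<longlongrightarrow> 0) at_top}"

definition ae_class :: "(real \<Rightarrow> complex) \<Rightarrow> (real \<Rightarrow> complex) set" where
  "ae_class g = {h \<in> borel_measurable borel. AE \<omega> in lborel. h \<omega> = g \<omega>}"

text \<open>An element of either Hilbert space is represented by its Fourier transform, as an
  almost-everywhere class of functions.\<close>

definition H_cdf :: "real \<Rightarrow> (real \<Rightarrow> complex) set set" where
  "H_cdf \<epsilon> = {ae_class h | h. h \<in> borel_measurable borel \<and>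
     (\<integral>\<^sup>+\<omega>. ennreal (\<omega>\<^sup>2 / (\<omega>\<^sup>2 + \<epsilon>) * (cmod (h \<omega>))\<^sup>2) \<partial>lborel) < \<infinity>}"

definition H_spec :: "real \<Rightarrow> (real \<Rightarrow> complex) set set" where
  "H_spec \<epsilon> = {ae_class g | g. g \<in> borel_measurable borel \<and>
     ennreal (1 / (2 * pi)) * (\<integral>\<^sup>+\<omega>. ennreal ((cmod (g \<omega>))\<^sup>2 / (\<omega>\<^sup>2 + \<epsilon>)) \<partial>lborel) < \<infinity>}"

definition U_spec :: "real \<Rightarrow> (real \<Rightarrow> complex) set \<Rightarrow> (real \<Rightarrow> complex) set" where
  "U_spec \<epsilon> = (\<lambda>H\<in>H_cdf \<epsilon>. \<Union>h\<in>H. ae_class (\<lambda>\<omega>. - of_real (sqrt (2 * pi)) * \<i> * of_real \<omega> * cnj (h \<omega>)))"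

lemma ae_class_cong: 
  assumes "AE \<omega> in lborel. g \<omega> = h \<omega>" shows "ae_class g = ae_class h"
  unfolding ae_class_def using assms by (auto elim!: eventually_elim2)

lemma ae_class_self: "g \<in> borel_measurable borel \<Longrightarrow> g \<in> ae_class g"
  by (simp add: ae_class_def)

lemma U_spec_ae_class:
  assumes h: "h \<in> borel_measurable borel" and H: "ae_class h \<in> H_cdf \<epsilon>"
  shows "U_spec \<epsilon> (ae_class h) = ae_class (\<lambda>\<omega>. - of_real (sqrt (2 * pi)) * \<i> * of_real \<omega> * cnj (h \<omega>))"
proof -
  let ?u = "\<lambda>h \<omega>. - of_real (sqrt (2 * pi)) * \<i> * of_real \<omega> * cnj (h \<omega>)"
  have "ae_class (?u k) = ae_class (?u h)" if "k \<in> ae_class h" for k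
    using that by (intro ae_class_cong) (auto simp: ae_class_def)
  then have "(\<Union>k\<in>ae_class h. ae_class (?u k)) = (\<Union>k\<in>ae_class h. ae_class (?u h))"
    by (rule SUP_cong[OF refl])
  also have "\<dots> = ae_class (?u h)"
    using ae_class_self[OF h] by blast
  finally show ?thesis
    unfolding U_spec_def restrict_apply'[OF H] .
qed

lemma U_spec_in_H_spec:
  assumes "\<epsilon> > 0"
  shows "U_spec \<epsilon> \<in> H_cdf \<epsilon> \<rightarrow>\<^sub>E H_spec \<epsilon>"
proof (rule PiE_I)
  fix H assume H: "H \<in> H_cdf \<epsilon>"
  then obtain h where h[measurable]: "h \<in> borel_measurable borel" and Hh: "H = ae_class h"
    and fin: "(\<integral>\<^sup>+\<omega>. ennreal (\<omega>\<^sup>2 / (\<omega>\<^sup>2 + \<epsilon>) * (cmod (h \<omega>))\<^sup>2) \<partial>lborel) < \<infinity>"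
    by (auto simp: H_cdf_def)
  define u where "u = (\<lambda>\<omega>. - of_real (sqrt (2 * pi)) * \<i> * of_real \<omega> * cnj (h \<omega>))"
  have [measurable]: "u \<in> borel_measurable borel"
  proof -
    have "(\<lambda>\<omega>. cnj (h \<omega>)) \<in> borel_measurable borel"
      by (rule measurable_compose[OF h borel_measurable_continuous_onI])
         (intro continuous_intros)
    then show ?thesis
      unfolding u_def by measurable
  qed
  have "ennreal (1 / (2 * pi)) * (\<integral>\<^sup>+\<omega>. ennreal ((cmod (u \<omega>))\<^sup>2 / (\<omega>\<^sup>2 + \<epsilon>)) \<partial>lborel)
      = (\<integral>\<^sup>+\<omega>. ennreal (1 / (2 * pi)) * ennreal ((cmod (u \<omega>))\<^sup>2 / (\<omega>\<^sup>2 + \<epsilon>)) \<partial>lborel)"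
    by (rule nn_integral_cmult[symmetric]) measurable
  also have "\<dots> = (\<integral>\<^sup>+\<omega>. ennreal (\<omega>\<^sup>2 / (\<omega>\<^sup>2 + \<epsilon>) * (cmod (h \<omega>))\<^sup>2) \<partial>lborel)"
    using assms
    by (intro nn_integral_cong, subst ennreal_mult[symmetric])
       (auto simp: u_def norm_mult power_mult_distrib field_simps)
  finally show "U_spec \<epsilon> H \<in> H_spec \<epsilon>"
    using fin \<open>u \<in> borel_measurable borel\<close>
    unfolding Hh U_spec_ae_class[OF h H[unfolded Hh]] H_spec_def u_def[symmetric] mem_Collect_eq
    by (intro exI[of _ u]) simp
qed (simp add: U_spec_def)

definition V_spec :: "real \<Rightarrow> (real \<Rightarrow> real) \<Rightarrow> (real \<Rightarrow> complex) set" where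
  "V_spec \<epsilon> F = U_spec \<epsilon> (L2_fourier (\<lambda>x. complex_of_real (centre F x)))"

definition V_field ::
  "('s, 'a) mdp \<Rightarrow> real \<Rightarrow> ('s \<times> 'a \<Rightarrow> real \<Rightarrow> real) \<Rightarrow> 's \<times> 'a \<Rightarrow> (real \<Rightarrow> complex) set" where
  "V_field M \<epsilon> F = (\<lambda>z\<in>space (sa_space M). V_spec \<epsilon> (F z))"

definition X_adm :: "('s, 'a) mdp \<Rightarrow> real \<Rightarrow> ('s \<times> 'a \<Rightarrow> (real \<Rightarrow> complex) set) set" where
  "X_adm M \<epsilon> = V_field M \<epsilon> ` X_cdf M"

definition V_field_inv ::
  "('s, 'a) mdp \<Rightarrow> real \<Rightarrow> ('s \<times> 'a \<Rightarrow> (real \<Rightarrow> complex) set) \<Rightarrow> 's \<times> 'a \<Rightarrow> real \<Rightarrow> real" where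
  "V_field_inv M \<epsilon> = inv_into (X_cdf M) (V_field M \<epsilon>)"

definition d_adm ::
  "('s, 'a) mdp \<Rightarrow> real \<Rightarrow> ('s \<times> 'a \<Rightarrow> (real \<Rightarrow> complex) set) \<Rightarrow> ('s \<times> 'a \<Rightarrow> (real \<Rightarrow> complex) set)
     \<Rightarrow> ennreal" where
  "d_adm M \<epsilon> \<nu> \<nu>' = d_Cr M (V_field_inv M \<epsilon> \<nu>) (V_field_inv M \<epsilon> \<nu>')"

definition T_adm ::
  "('s, 'a) mdp \<Rightarrow> ('s, 'a) policy \<Rightarrow> real \<Rightarrow> real \<Rightarrow> ('s \<times> 'a \<Rightarrow> (real \<Rightarrow> complex) set)
     \<Rightarrow> 's \<times> 'a \<Rightarrow> (real \<Rightarrow> complex) set" where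
  "T_adm M \<pi> \<alpha> \<epsilon> = (\<lambda>\<nu>\<in>X_adm M \<epsilon>. V_field M \<epsilon> (T_cdf M \<pi> \<alpha> (V_field_inv M \<epsilon> \<nu>)))"

end

theory Submission
  imports Defs
begin

text \<open>
  Jensen's inequality under the transition kernel and the substitution \<open>x \<mapsto> (x - t) / \<gamma>\<close> make the
  operator a contraction with factor \<open>sqrt \<gamma>\<close> for the Cramer metric. The law of the chain started in
  \<open>z\<close> is the mixture over one kernel step of the laws of the chains started in the next state with \<open>z\<close>
  prepended; applied to the soft return this yields the Bellman equation, so the return CDF is the fixed
  point and the iterates converge to it. The transport of these facts needs injectivity of the spectral
  map, hence a Plancherel theorem, needed only for bounded, almost everywhere continuous
  functions: Parseval's identity for such integrable functions comes from a Gaussian regularisation, and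
  the limit in the mean exists because the truncated transforms form a Cauchy sequence.
\<close>

section \<open>The Fourier transform on bounded, almost everywhere continuous functions\<close>

text \<open>A centred CDF in \<open>Gamma_F\<close> is square integrable but need not be integrable,
  since tails of order \<open>1 / x\<close> are allowed; its transform exists only as a limit in the
  mean. A CDF is, however, bounded and monotone, hence continuous off a countable set, so averages
  over a shrinking Gaussian converge at almost every point and dominated convergence applies. The
  transform fixes its function only up to a null set; right continuity of CDFs removes this
  ambiguity. It also yields the joint measurability behind Tonelli, as \<open>X_cdf\<close> asks for
  measurability in the pair at each fixed argument only. On the probabilistic side, the trajectory
  law is built by appending coordinates, whereas the Bellman equation splits off the first one:
  measurability in the starting pair and the first-step identity are therefore obtained on cylinder
  sets. The first-moment hypothesis keeps \<open>X_cdf\<close> invariant, because translating a unit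
  step by \<open>t\<close> costs \<open>\<bar>t\<bar>\<close> in squared norm. The limit is known in
  advance as a fixed point, so convergence follows from the contraction estimate alone.\<close>

lemma borel_measurable_cnj[measurable]:
  "f \<in> borel_measurable M \<Longrightarrow> (\<lambda>x. cnj (f x)) \<in> borel_measurable M"
  by (rule measurable_compose[OF _ borel_measurable_continuous_onI]) (auto intro: continuous_intros)

text \<open>The product is dominated by \<open>B\<close> times \<open>norm (g x)\<close>, which is
  integrable for the product measure because \<open>N\<close> is finite. Integrability is asked of
  \<open>g\<close> alone, so a character or a bounded transform can serve as
  \<open>k\<close>.\<close>

lemma integral_swap_bounded:
  fixes g :: "'a \<Rightarrow> complex" and k :: "'b \<Rightarrow> 'a \<Rightarrow> complex"
  assumes N: "finite_measure N" and M: "sigma_finite_measure M" and g: "integrable M g"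
    and k[measurable]: "(\<lambda>(u, x). k u x) \<in> borel_measurable (N \<Otimes>\<^sub>M M)"
    and B: "\<And>u x. norm (k u x) \<le> B"
  shows "(\<integral>u. \<integral>x. g x * k u x \<partial>M \<partial>N) = (\<integral>x. g x * (\<integral>u. k u x \<partial>N) \<partial>M)"
proof -
  interpret N: finite_measure N by fact
  interpret M: sigma_finite_measure M by fact
  interpret pair_sigma_finite N M ..
  have [measurable]: "g \<in> borel_measurable M" using g by auto
  have "integrable (N \<Otimes>\<^sub>M M) (\<lambda>(u, x). g x * k u x)"
  proof (rule Fubini_integrable)
    have i: "integrable M (\<lambda>x. norm (g x * k u x))" if "u \<in> space N" for u
      using that
      by (intro integrable_norm Bochner_Integration.integrable_bound[OF integrable_mult_right[OF g, of B]])
         (auto simp: norm_mult mult.commute[of "\<bar>B\<bar>"] intro!: mult_left_mono order_trans[OF B])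
    show "integrable N (\<lambda>u. \<integral>x. norm (case (u, x) of (u, x) \<Rightarrow> g x * k u x) \<partial>M)"
    proof (rule N.integrable_const_bound[where B="(\<integral>x. norm (g x) \<partial>M) * B"])
      show "AE u in N. norm (\<integral>x. norm (case (u, x) of (u, x) \<Rightarrow> g x * k u x) \<partial>M) \<le> (\<integral>x. norm (g x) \<partial>M) * B"
      proof (rule AE_I2)
        fix u assume u: "u \<in> space N"
        have "(\<integral>x. norm (g x * k u x) \<partial>M) \<le> (\<integral>x. norm (g x) * B \<partial>M)"
          using i[OF u] g by (intro integral_mono) (auto simp: norm_mult intro!: mult_left_mono B)
        then show "norm (\<integral>x. norm (case (u, x) of (u, x) \<Rightarrow> g x * k u x) \<partial>M) \<le> (\<integral>x. norm (g x) \<partial>M) * B"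
          by simp
      qed
    qed measurable
    show "AE u in N. integrable M (\<lambda>x. case (u, x) of (u, x) \<Rightarrow> g x * k u x)"
      using i by (intro AE_I2) (simp add: integrable_norm_iff)
  qed measurable
  then have "(\<integral>u. \<integral>x. g x * k u x \<partial>M \<partial>N) = (\<integral>x. \<integral>u. g x * k u x \<partial>N \<partial>M)"
    by (intro Fubini_integral[symmetric])
  then show ?thesis by simp
qed

section \<open>Parseval's identity for integrable functions\<close>

definition fourier :: "(real \<Rightarrow> complex) \<Rightarrow> real \<Rightarrow> complex" where
  "fourier g \<omega> = (\<integral>x. g x * exp (- \<i> * of_real (\<omega> * x)) \<partial>lborel)"

lemma fourier_measurable[measurable]:
  assumes [measurable]: "g \<in> borel_measurable borel"
  shows "fourier g \<in> borel_measurable borel"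
  unfolding fourier_def by measurable

lemma cnj_fourier: "cnj (fourier g \<omega>) = (\<integral>x. cnj (g x) * exp (\<i> * of_real (\<omega> * x)) \<partial>lborel)"
  by (simp add: fourier_def exp_cnj flip: Bochner_Integration.integral_cnj)

lemma norm_fourier_le:
  assumes "integrable lborel g"
  shows "norm (fourier g \<omega>) \<le> (\<integral>x. norm (g x) \<partial>lborel)"
proof -
  have "norm (fourier g \<omega>) \<le> (\<integral>x. norm (g x * exp (- \<i> * of_real (\<omega> * x))) \<partial>lborel)"
    unfolding fourier_def by (rule integral_norm_bound)
  also have "\<dots> = (\<integral>x. norm (g x) \<partial>lborel)"
    by (simp add: norm_mult)
  finally show ?thesis .
qed

lemma finite_std_normal: "finite_measure std_normal_distribution"
  using real_dist_normal_dist unfolding real_distribution_def prob_space_def by auto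

text \<open>Expanding the square as a transform times its conjugate gives integrals over
  \<open>x\<close> and \<open>y\<close>, and the expectation over \<open>u\<close> of the two
  characters is the normal characteristic function at \<open>(y - x) / s\<close>. This is again a
  Gaussian in \<open>y\<close>; the substitution \<open>y = x + s * u\<close> turns it into the
  normal density, at the price of the Jacobian \<open>s\<close> and the normalisation
  \<open>sqrt (2 * pi)\<close>.\<close>

lemma expectation_fourier_scaled:
  fixes g :: "real \<Rightarrow> complex"
  assumes g: "integrable lborel g" and s: "s > 0"
  shows "(\<integral>u. complex_of_real ((norm (fourier g (u / s)))\<^sup>2) \<partial>std_normal_distribution)
     = of_real (s * sqrt (2 * pi)) * (\<integral>x. g x * (\<integral>u. cnj (g (x + s * u)) \<partial>std_normal_distribution) \<partial>lborel)"
proof -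
  let ?N = std_normal_distribution
  have [measurable]: "g \<in> borel_measurable borel" using g by simp
  have cg: "integrable lborel (\<lambda>x. cnj (g x))" using g by simp
  let ?I = "\<integral>x. norm (g x) \<partial>lborel"
  have "(\<integral>u. complex_of_real ((norm (fourier g (u / s)))\<^sup>2) \<partial>?N)
      = (\<integral>u. \<integral>x. g x * (exp (- \<i> * of_real (u / s * x)) * cnj (fourier g (u / s))) \<partial>lborel \<partial>?N)"
    by (intro Bochner_Integration.integral_cong refl)
       (simp add: complex_norm_square fourier_def mult.assoc[symmetric] del: of_real_power)
  \<comment> \<open>The factor \<open>cnj (fourier g (u / s))\<close> stays unexpanded in this
    exchange: it is bounded by the L1 norm \<open>?I\<close> and so passes as part of the bounded
    kernel.\<close>
  also have "\<dots> = (\<integral>x. g x * (\<integral>u. exp (- \<i> * of_real (u / s * x)) * cnj (fourier g (u / s)) \<partial>?N) \<partial>lborel)"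
    by (rule integral_swap_bounded[OF finite_std_normal _ g, of _ ?I])
       (auto simp: norm_mult norm_fourier_le[OF g] intro: lborel.sigma_finite_measure_axioms)
  also have "\<dots> = (\<integral>x. g x * (of_real (s * sqrt (2 * pi)) * (\<integral>u. cnj (g (x + s * u)) \<partial>?N)) \<partial>lborel)"
  proof (intro Bochner_Integration.integral_cong refl arg_cong2[where f="(*)"])
    fix x
    have "(\<integral>u. exp (- \<i> * of_real (u / s * x)) * cnj (fourier g (u / s)) \<partial>?N)
        = (\<integral>u. \<integral>y. cnj (g y) * (exp (- \<i> * of_real (u / s * x)) * exp (\<i> * of_real (u / s * y))) \<partial>lborel \<partial>?N)"
      by (intro Bochner_Integration.integral_cong refl)
         (simp add: cnj_fourier mult_ac flip: integral_mult_right_zero)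
    also have "\<dots> = (\<integral>y. cnj (g y) * (\<integral>u. exp (- \<i> * of_real (u / s * x)) * exp (\<i> * of_real (u / s * y)) \<partial>?N) \<partial>lborel)"
      by (rule integral_swap_bounded[OF finite_std_normal _ cg, of _ 1])
         (auto simp: norm_mult intro: lborel.sigma_finite_measure_axioms)
    also have "\<dots> = (\<integral>y. cnj (g y) * of_real (exp (- (((y - x) / s)\<^sup>2) / 2)) \<partial>lborel)"
    proof (intro Bochner_Integration.integral_cong refl arg_cong2[where f="(*)"])
      fix y
      have "(\<integral>u. exp (- \<i> * of_real (u / s * x)) * exp (\<i> * of_real (u / s * y)) \<partial>?N) = char ?N ((y - x) / s)"
        unfolding char_def
        by (intro Bochner_Integration.integral_cong refl)
           (simp add: exp_add[symmetric] algebra_simps diff_divide_distrib)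
      then show "(\<integral>u. exp (- \<i> * of_real (u / s * x)) * exp (\<i> * of_real (u / s * y)) \<partial>?N) = of_real (exp (- (((y - x) / s)\<^sup>2) / 2))"
        by (simp add: char_std_normal_distribution)
    qed
    also have "\<dots> = \<bar>s\<bar> *\<^sub>R (\<integral>u. cnj (g (x + s * u)) * of_real (exp (- ((((x + s * u) - x) / s)\<^sup>2) / 2)) \<partial>lborel)"
      using s by (intro lborel_integral_real_affine) auto
    also have "\<dots> = of_real s * (\<integral>u. cnj (g (x + s * u)) * of_real (exp (- (u\<^sup>2) / 2)) \<partial>lborel)"
      using s by (simp add: scaleR_conv_of_real)
    also have "(\<integral>u. cnj (g (x + s * u)) * of_real (exp (- (u\<^sup>2) / 2)) \<partial>lborel)
        = of_real (sqrt (2 * pi)) * (\<integral>u. cnj (g (x + s * u)) \<partial>?N)"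
      by (subst integral_density)
         (auto simp: normal_density_nonneg normal_density_def scaleR_conv_of_real mult_ac)
    finally show "(\<integral>u. exp (- \<i> * of_real (u / s * x)) * cnj (fourier g (u / s)) \<partial>?N)
       = of_real (s * sqrt (2 * pi)) * (\<integral>u. cnj (g (x + s * u)) \<partial>?N)" by simp
  qed
  finally show ?thesis
    by (simp add: mult.left_commute[of "g _"] flip: of_real_mult)
qed

text \<open>The substitution \<open>\<omega> = u / s\<close> turns the normal expectation into a
  Gaussian damping of the transform; \<open>1 / s\<close>, \<open>s\<close> and the two factors
  \<open>sqrt (2 * pi)\<close> combine to \<open>2 * pi\<close>. The damping increases to 1 as
  \<open>s\<close> decreases to 0, which prepares monotone convergence.\<close>

lemma nn_integral_fourier_gaussian:
  fixes g :: "real \<Rightarrow> complex"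
  assumes g: "integrable lborel g" and s: "s > 0"
  shows "(\<integral>\<^sup>+\<omega>. ennreal ((norm (fourier g \<omega>))\<^sup>2 * exp (- (s * \<omega>)\<^sup>2 / 2)) \<partial>lborel)
     = ennreal (2 * pi * Re (\<integral>x. g x * (\<integral>u. cnj (g (x + s * u)) \<partial>std_normal_distribution) \<partial>lborel))"
proof -
  let ?N = std_normal_distribution
  have [measurable]: "g \<in> borel_measurable borel" using g by simp
  interpret N: finite_measure ?N by (rule finite_std_normal)
  let ?R = "Re (\<integral>x. g x * (\<integral>u. cnj (g (x + s * u)) \<partial>std_normal_distribution) \<partial>lborel)"
  have i: "integrable ?N (\<lambda>u. (norm (fourier g (u / s)))\<^sup>2)"
    by (rule N.integrable_const_bound[where B="(\<integral>x. norm (g x) \<partial>lborel)\<^sup>2"])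
       (auto intro!: power_mono norm_fourier_le[OF g])
  have r: "(\<integral>u. (norm (fourier g (u / s)))\<^sup>2 \<partial>?N) = s * sqrt (2 * pi) * ?R"
    using arg_cong[OF expectation_fourier_scaled[OF g s], of Re] by (simp del: of_real_power of_real_mult add: Re_complex_of_real[of "_ * _"])
  have "(\<integral>\<^sup>+\<omega>. ennreal ((norm (fourier g \<omega>))\<^sup>2 * exp (- (s * \<omega>)\<^sup>2 / 2)) \<partial>lborel)
    = ennreal \<bar>1 / s\<bar> * (\<integral>\<^sup>+u. ennreal ((norm (fourier g (0 + (1 / s) * u)))\<^sup>2 * exp (- (s * (0 + (1 / s) * u))\<^sup>2 / 2)) \<partial>lborel)"
    using s by (intro nn_integral_real_affine) auto
  also have "(\<integral>\<^sup>+u. ennreal ((norm (fourier g (0 + (1 / s) * u)))\<^sup>2 * exp (- (s * (0 + (1 / s) * u))\<^sup>2 / 2)) \<partial>lborel)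
     = (\<integral>\<^sup>+u. ennreal (sqrt (2 * pi)) * (ennreal (std_normal_density u) * ennreal ((norm (fourier g (u / s)))\<^sup>2)) \<partial>lborel)"
    using s by (intro nn_integral_cong) (simp add: normal_density_def flip: ennreal_mult)
  also have "\<dots> = ennreal (sqrt (2 * pi)) * (\<integral>\<^sup>+u. ennreal ((norm (fourier g (u / s)))\<^sup>2) \<partial>?N)"
    by (simp add: nn_integral_density nn_integral_cmult)
  also have "(\<integral>\<^sup>+u. ennreal ((norm (fourier g (u / s)))\<^sup>2) \<partial>?N) = ennreal (s * sqrt (2 * pi) * ?R)"
    using i by (simp add: nn_integral_eq_integral r)
  also have "ennreal \<bar>1 / s\<bar> * (ennreal (sqrt (2 * pi)) * ennreal (s * sqrt (2 * pi) * ?R)) = ennreal (2 * pi * ?R)"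
  proof -
    have "sqrt (2 * pi) * sqrt (2 * pi) = 2 * pi" by simp
    then show ?thesis using s by (simp add: mult.assoc[symmetric] flip: ennreal_mult' )
  qed
  finally show ?thesis .
qed
text \<open>The damped identity is followed on both sides as \<open>s\<close> tends to 0. On the
  left the integrands increase; on the right the Gaussian average of \<open>g\<close> around
  \<open>x\<close> converges at every continuity point, and \<open>B\<close> times
  \<open>norm (g x)\<close> dominates. Boundedness and continuity almost everywhere enter
  here.\<close>

lemma parseval:
  fixes g :: "real \<Rightarrow> complex"
  assumes g: "integrable lborel g" and B: "\<And>x. norm (g x) \<le> B" and c: "AE x in lborel. isCont g x"
  shows "(\<integral>\<^sup>+\<omega>. ennreal ((norm (fourier g \<omega>))\<^sup>2) \<partial>lborel) = ennreal (2 * pi) * (\<integral>\<^sup>+x. ennreal ((norm (g x))\<^sup>2) \<partial>lborel)"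
proof -
  let ?N = std_normal_distribution
  let ?s = "\<lambda>n. 1 / real (Suc n)"
  have [measurable]: "g \<in> borel_measurable borel" using g by simp
  interpret N: real_distribution ?N by (rule real_dist_normal_dist)
  have ib: "integrable ?N (\<lambda>u. cnj (g (x + s * u)))" for x s
    by (rule N.integrable_const_bound[where B=B]) (auto simp: B)
  have nb: "norm (\<integral>u. cnj (g (x + s * u)) \<partial>?N) \<le> B" for x s
  proof -
    have "norm (\<integral>u. cnj (g (x + s * u)) \<partial>?N) \<le> (\<integral>u. norm (cnj (g (x + s * u))) \<partial>?N)"
      by (rule integral_norm_bound)
    also have "\<dots> \<le> (\<integral>u. B \<partial>?N)"
      by (intro integral_mono integrable_norm ib) (auto simp: B)
    finally show ?thesis using N.prob_space by simp
  qed
  have s0: "?s \<longlonglongrightarrow> 0"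
    by (rule LIMSEQ_inverse_real_of_nat[unfolded inverse_eq_divide])
  have inner: "(\<lambda>n. \<integral>u. cnj (g (x + ?s n * u)) \<partial>?N) \<longlonglongrightarrow> cnj (g x)" if "isCont g x" for x
  proof -
    have "(\<lambda>n. \<integral>u. cnj (g (x + ?s n * u)) \<partial>?N) \<longlonglongrightarrow> (\<integral>u. cnj (g x) \<partial>?N)"
    proof (rule integral_dominated_convergence[where w="\<lambda>_. B"])
      show "AE u in ?N. (\<lambda>n. cnj (g (x + ?s n * u))) \<longlonglongrightarrow> cnj (g x)"
      proof (rule AE_I2)
        fix u
        have "(\<lambda>n. x + ?s n * u) \<longlonglongrightarrow> x + 0 * u"
          by (intro tendsto_intros s0)
        then show "(\<lambda>n. cnj (g (x + ?s n * u))) \<longlonglongrightarrow> cnj (g x)"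
          using that by (intro tendsto_intros isCont_tendsto_compose[of x g]) auto
      qed
    qed (auto simp: B)
    then show ?thesis using N.prob_space by simp
  qed
  have "(\<lambda>n. \<integral>x. g x * (\<integral>u. cnj (g (x + ?s n * u)) \<partial>?N) \<partial>lborel) \<longlonglongrightarrow> (\<integral>x. g x * cnj (g x) \<partial>lborel)"
  proof (rule integral_dominated_convergence[where w="\<lambda>x. norm (g x) * B"])
    show "AE x in lborel. (\<lambda>n. g x * (\<integral>u. cnj (g (x + ?s n * u)) \<partial>?N)) \<longlonglongrightarrow> g x * cnj (g x)"
      using c by eventually_elim (intro tendsto_intros inner)
    show "AE x in lborel. norm (g x * (\<integral>u. cnj (g (x + ?s n * u)) \<partial>?N)) \<le> norm (g x) * B" for n
      unfolding norm_mult by (intro AE_I2 mult_left_mono nb) simp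
  qed (use g in auto)
  from tendsto_Re[OF this]
  have "(\<lambda>n. Re (\<integral>x. g x * (\<integral>u. cnj (g (x + ?s n * u)) \<partial>?N) \<partial>lborel)) \<longlonglongrightarrow> (\<integral>x. (norm (g x))\<^sup>2 \<partial>lborel)"
    by (simp add: complex_norm_square[symmetric] del: of_real_power Bochner_Integration.integral_cnj)
  then have "(\<lambda>n. ennreal (2 * pi * Re (\<integral>x. g x * (\<integral>u. cnj (g (x + ?s n * u)) \<partial>?N) \<partial>lborel))) \<longlonglongrightarrow> ennreal (2 * pi * (\<integral>x. (norm (g x))\<^sup>2 \<partial>lborel))"
    by (intro tendsto_intros)
  moreover have "(\<lambda>n. \<integral>\<^sup>+\<omega>. ennreal ((norm (fourier g \<omega>))\<^sup>2 * exp (- (?s n * \<omega>)\<^sup>2 / 2)) \<partial>lborel)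
     \<longlonglongrightarrow> (\<integral>\<^sup>+\<omega>. ennreal ((norm (fourier g \<omega>))\<^sup>2) \<partial>lborel)"
  proof (rule nn_integral_LIMSEQ)
    show "incseq (\<lambda>n \<omega>. ennreal ((norm (fourier g \<omega>))\<^sup>2 * exp (- (?s n * \<omega>)\<^sup>2 / 2)))"
    proof (intro incseq_SucI le_funI ennreal_leI mult_left_mono)
      fix n \<omega>
      have "(?s (Suc n) * \<omega>)\<^sup>2 \<le> (?s n * \<omega>)\<^sup>2"
        unfolding power_mult_distrib by (intro mult_right_mono power_mono) (auto simp: frac_le)
      then show "exp (- (?s n * \<omega>)\<^sup>2 / 2) \<le> exp (- (?s (Suc n) * \<omega>)\<^sup>2 / 2)"
        by simp
    qed simp
    show "(\<lambda>n. ennreal ((norm (fourier g \<omega>))\<^sup>2 * exp (- (?s n * \<omega>)\<^sup>2 / 2))) \<longlonglongrightarrow> ennreal ((norm (fourier g \<omega>))\<^sup>2)" for \<omega>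
    proof -
      have "(\<lambda>n. ennreal ((norm (fourier g \<omega>))\<^sup>2 * exp (- (?s n * \<omega>)\<^sup>2 / 2))) \<longlonglongrightarrow> ennreal ((norm (fourier g \<omega>))\<^sup>2 * exp (- (0 * \<omega>)\<^sup>2 / 2))"
        by (intro tendsto_intros s0) auto
      then show ?thesis by simp
    qed
  qed measurable
  then have "(\<lambda>n. ennreal (2 * pi * Re (\<integral>x. g x * (\<integral>u. cnj (g (x + ?s n * u)) \<partial>?N) \<partial>lborel)))
     \<longlonglongrightarrow> (\<integral>\<^sup>+\<omega>. ennreal ((norm (fourier g \<omega>))\<^sup>2) \<partial>lborel)"
    by (subst (asm) nn_integral_fourier_gaussian[OF g]) simp_all
  ultimately have "(\<integral>\<^sup>+\<omega>. ennreal ((norm (fourier g \<omega>))\<^sup>2) \<partial>lborel) = ennreal (2 * pi * (\<integral>x. (norm (g x))\<^sup>2 \<partial>lborel))"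
    by (intro LIMSEQ_unique)
  \<comment> \<open>The square of \<open>norm (g x)\<close> is at most \<open>B\<close> times
    \<open>norm (g x)\<close>, so the real integral may be rewritten as a nonnegative one.\<close>
  also have "integrable lborel (\<lambda>x. (norm (g x))\<^sup>2)"
    by (rule Bochner_Integration.integrable_bound[OF integrable_mult_right[OF integrable_norm[OF g], of B]])
       (auto simp: power2_eq_square abs_mult intro!: mult_right_mono order_trans[OF B])
  then have "ennreal (2 * pi * (\<integral>x. (norm (g x))\<^sup>2 \<partial>lborel)) = ennreal (2 * pi) * (\<integral>\<^sup>+x. ennreal ((norm (g x))\<^sup>2) \<partial>lborel)"
    by (subst nn_integral_eq_integral) (auto simp: ennreal_mult)
  finally show ?thesis .
qed

section \<open>Squared L2 norms and mean-square limits\<close>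

abbreviation l2sq :: "(real \<Rightarrow> complex) \<Rightarrow> ennreal" where
  "l2sq f \<equiv> \<integral>\<^sup>+x. ennreal ((cmod (f x))\<^sup>2) \<partial>lborel"

lemma power2_norm_add_le: "(norm (a + b))\<^sup>2 \<le> 2 * (norm a)\<^sup>2 + 2 * (norm (b :: 'b::real_normed_vector))\<^sup>2"
proof -
  have "(norm (a + b))\<^sup>2 \<le> (norm a + norm b)\<^sup>2"
    by (intro power_mono norm_triangle_ineq) auto
  also have "\<dots> \<le> 2 * (norm a)\<^sup>2 + 2 * (norm b)\<^sup>2"
    using sum_squares_bound[of "norm a" "norm b"] by (simp add: power2_sum)
  finally show ?thesis .
qed

text \<open>A triangle inequality for squares with \<open>h\<close> as intermediate point. The
  factors 2 do no harm, because it serves only for finiteness and for limits equal to 0.\<close>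

lemma l2sq_diff_le:
  assumes [measurable]: "f \<in> borel_measurable borel" "g \<in> borel_measurable borel" "h \<in> borel_measurable borel"
  shows "l2sq (\<lambda>x. f x - g x) \<le> 2 * l2sq (\<lambda>x. h x - f x) + 2 * l2sq (\<lambda>x. h x - g x)"
proof -
  have "l2sq (\<lambda>x. f x - g x) \<le> (\<integral>\<^sup>+x. 2 * ennreal ((cmod (h x - f x))\<^sup>2) + 2 * ennreal ((cmod (h x - g x))\<^sup>2) \<partial>lborel)"
  proof (intro nn_integral_mono)
    fix x
    have "(cmod (f x - g x))\<^sup>2 \<le> 2 * (cmod (h x - f x))\<^sup>2 + 2 * (cmod (h x - g x))\<^sup>2"
      using power2_norm_add_le[of "f x - h x" "h x - g x"] by (simp add: norm_minus_commute)
    from ennreal_leI[OF this]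
    show "ennreal ((cmod (f x - g x))\<^sup>2) \<le> 2 * ennreal ((cmod (h x - f x))\<^sup>2) + 2 * ennreal ((cmod (h x - g x))\<^sup>2)"
      by (simp add: ennreal_mult)
  qed
  also have "\<dots> = 2 * l2sq (\<lambda>x. h x - f x) + 2 * l2sq (\<lambda>x. h x - g x)"
    by (simp add: nn_integral_add nn_integral_cmult)
  finally show ?thesis .
qed

lemma l2sq_eq_0_iff:
  assumes [measurable]: "f \<in> borel_measurable borel" "g \<in> borel_measurable borel"
  shows "l2sq (\<lambda>x. f x - g x) = 0 \<longleftrightarrow> (AE x in lborel. f x = g x)"
  by (subst nn_integral_0_iff_AE) (auto simp: ennreal_eq_0_iff)

text \<open>The criterion \<open>cauchy_L1_AE_cauchy_subseq\<close> speaks of L1 distances, which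
  mean-square distances control on a finite measure. The standard normal law is chosen because its
  density is at most 1, so smallness for \<open>lborel\<close> carries over, and positive, so almost
  everywhere convergence carries back.\<close>

lemma L2_Cauchy_AE_convergent_subseq:
  fixes s :: "nat \<Rightarrow> real \<Rightarrow> complex"
  assumes [measurable]: "\<And>n. s n \<in> borel_measurable borel"
    and fin: "\<And>n. l2sq (s n) < \<infinity>"
    and cau: "\<And>e::real. e > 0 \<Longrightarrow> \<exists>N. \<forall>i\<ge>N. \<forall>j\<ge>N. l2sq (\<lambda>x. s i x - s j x) < ennreal e"
  obtains r h where "strict_mono r" "h \<in> borel_measurable borel" "AE x in lborel. (\<lambda>i. s (r i) x) \<longlonglongrightarrow> h x"
proof -
  let ?N = std_normal_distribution
  interpret N: real_distribution ?N by (rule real_dist_normal_dist)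
  have le: "(\<integral>\<^sup>+x. ennreal ((cmod (f x))\<^sup>2) \<partial>?N) \<le> l2sq f" if [measurable]: "f \<in> borel_measurable borel" for f
  proof -
    have "1 \<le> sqrt (2 * pi)"
      using pi_gt3 by (intro real_le_rsqrt) simp
    then have "std_normal_density x \<le> 1" for x
      using frac_le[of 1 "exp (- x\<^sup>2 / 2)" 1 "sqrt (2 * pi)"] by (simp add: normal_density_def)
    then have "ennreal (std_normal_density x) * ennreal ((cmod (f x))\<^sup>2) \<le> 1 * ennreal ((cmod (f x))\<^sup>2)" for x
      by (intro mult_right_mono) auto
    then show ?thesis
      by (subst nn_integral_density) (auto intro!: nn_integral_mono)
  qed
  have sq: "integrable ?N (\<lambda>x. (cmod (f x))\<^sup>2)" if [measurable]: "f \<in> borel_measurable borel" and "l2sq f < \<infinity>" for f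
    using le[OF that(1)] that(2) by (intro integrableI_bounded) (auto intro: le_less_trans)
  \<comment> \<open>This takes the role of the Cauchy-Schwarz inequality. With the tolerance
    \<open>e\<^sup>2\<close> for squared distances chosen below, the total is less than
    \<open>e / 2 + e\<^sup>2 / (2 * e) = e\<close>.\<close>
  have amgm: "cmod z \<le> e / 2 + (cmod z)\<^sup>2 / (2 * e)" if "e > 0" for z e
  proof -
    have "cmod z * (2 * e) \<le> (cmod z)\<^sup>2 + e\<^sup>2"
      using sum_squares_bound[of "cmod z" e] by simp
    then have "cmod z \<le> ((cmod z)\<^sup>2 + e\<^sup>2) / (2 * e)"
      using that by (subst pos_le_divide_eq) auto
    also have "\<dots> = e / 2 + (cmod z)\<^sup>2 / (2 * e)"
      using that by (simp add: add_divide_distrib power2_eq_square)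
    finally show ?thesis .
  qed
  have int: "integrable ?N f" if f[measurable]: "f \<in> borel_measurable borel" and "l2sq f < \<infinity>" for f
  proof (rule Bochner_Integration.integrable_bound)
    show "integrable ?N (\<lambda>x. 1 / 2 + (cmod (f x))\<^sup>2 / 2)"
      by (intro Bochner_Integration.integrable_add integrable_divide sq[OF that]) auto
    show "AE x in ?N. norm (f x) \<le> norm (1 / 2 + (cmod (f x))\<^sup>2 / 2)"
      using amgm[of 1] by (auto intro!: AE_I2 order_trans[OF _ abs_ge_self])
  qed simp
  obtain r where r: "strict_mono r" "AE x in ?N. Cauchy (\<lambda>i. s (r i) x)"
  proof (rule cauchy_L1_AE_cauchy_subseq[of ?N s])
    show "integrable ?N (s n)" for n by (rule int[OF _ fin]) simp
    fix e :: real assume e: "e > 0"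
    then obtain n where n: "\<And>i j. i \<ge> n \<Longrightarrow> j \<ge> n \<Longrightarrow> l2sq (\<lambda>x. s i x - s j x) < ennreal (e\<^sup>2)"
      using cau[of "e\<^sup>2"] by auto
    have "(\<integral>x. cmod (s i x - s j x) \<partial>?N) < e" if "i \<ge> n" "j \<ge> n" for i j
    proof -
      let ?f = "\<lambda>x. s i x - s j x"
      have fin: "l2sq ?f < \<infinity>" using n[OF that] by (auto intro: less_trans)
      have "ennreal (\<integral>x. (cmod (?f x))\<^sup>2 \<partial>?N) = (\<integral>\<^sup>+x. ennreal ((cmod (?f x))\<^sup>2) \<partial>?N)"
        by (subst nn_integral_eq_integral[OF sq[OF _ fin]]) auto
      also have "\<dots> \<le> l2sq ?f" by (rule le) simp
      also have "\<dots> < ennreal (e\<^sup>2)" by (rule n[OF that])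
      finally have *: "(\<integral>x. (cmod (?f x))\<^sup>2 \<partial>?N) < e\<^sup>2" by (simp add: ennreal_less_iff)
      have "(\<integral>x. cmod (?f x) \<partial>?N) \<le> (\<integral>x. e / 2 + (cmod (?f x))\<^sup>2 / (2 * e) \<partial>?N)"
        using e by (intro integral_mono amgm Bochner_Integration.integrable_add integrable_divide sq[OF _ fin]
              integrable_norm int[OF _ fin]) auto
      also have "\<dots> = e / 2 + (\<integral>x. (cmod (?f x))\<^sup>2 \<partial>?N) / (2 * e)"
        using N.prob_space
        by (subst Bochner_Integration.integral_add) (auto intro!: integrable_divide sq[OF _ fin])
      also have "\<dots> < e / 2 + e\<^sup>2 / (2 * e)"
        using e by (intro add_strict_left_mono divide_strict_right_mono[OF *]) auto
      also have "\<dots> = e"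
        using e by (simp add: power2_eq_square)
      finally show ?thesis .
    qed
    then show "\<exists>N. \<forall>i\<ge>N. \<forall>j\<ge>N. (\<integral>x. cmod (s i x - s j x) \<partial>?N) < e" by blast
  qed
  define h where "h x = lim (\<lambda>i. s (r i) x)" for x
  show thesis
  proof (rule that[OF r(1)])
    show "h \<in> borel_measurable borel" unfolding h_def by measurable
    have "AE x in lborel. Cauchy (\<lambda>i. s (r i) x)"
      using r(2) by (subst (asm) AE_density) (auto simp: normal_density_pos)
    then show "AE x in lborel. (\<lambda>i. s (r i) x) \<longlonglongrightarrow> h x"
      by eventually_elim (simp add: h_def Cauchy_convergent convergent_LIMSEQ_iff[symmetric])
  qed
qed

text \<open>Fatou's lemma applied to the squared distances to a fixed \<open>t\<close>; the bound
  has to hold only eventually, which suits a cutoff that is overtaken by the subsequence.\<close>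

lemma l2sq_Fatou:
  assumes [measurable]: "\<And>n. s n \<in> borel_measurable borel" "h \<in> borel_measurable borel" "t \<in> borel_measurable borel"
    and lim: "AE x in lborel. (\<lambda>i. s i x) \<longlonglongrightarrow> h x"
    and C: "\<forall>\<^sub>F i in sequentially. l2sq (\<lambda>x. s i x - t x) \<le> C"
  shows "l2sq (\<lambda>x. h x - t x) \<le> C"
proof -
  have "l2sq (\<lambda>x. h x - t x) = (\<integral>\<^sup>+x. liminf (\<lambda>i. ennreal ((cmod (s i x - t x))\<^sup>2)) \<partial>lborel)"
  proof (rule nn_integral_cong_AE, use lim in eventually_elim)
    fix x assume "(\<lambda>i. s i x) \<longlonglongrightarrow> h x"
    then have "(\<lambda>i. ennreal ((cmod (s i x - t x))\<^sup>2)) \<longlonglongrightarrow> ennreal ((cmod (h x - t x))\<^sup>2)"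
      by (intro tendsto_intros)
    then show "ennreal ((cmod (h x - t x))\<^sup>2) = liminf (\<lambda>i. ennreal ((cmod (s i x - t x))\<^sup>2))"
      by (intro lim_imp_Liminf[symmetric]) auto
  qed
  also have "\<dots> \<le> liminf (\<lambda>i. l2sq (\<lambda>x. s i x - t x))"
    by (intro nn_integral_liminf) measurable
  also have "\<dots> \<le> C"
    using C by (intro Liminf_le) auto
  finally show ?thesis .
qed

section \<open>The L2 transform of bounded, almost everywhere continuous functions\<close>

text \<open>The class on which \<open>parseval\<close> holds once integrability is added. It
  contains the centred CDFs and is closed under differences and truncation, the operations performed
  before transforming.\<close>

definition bounded_AE_cont :: "(real \<Rightarrow> complex) \<Rightarrow> bool" where
  "bounded_AE_cont f \<longleftrightarrow> f \<in> borel_measurable borel \<and> bounded (range f) \<and> (AE x in lborel. isCont f x)"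

lemma trunc_fourier_eq:
  "trunc_fourier T f \<omega> = of_real (1 / sqrt (2 * pi)) * fourier (\<lambda>x. indicator {-T..T} x * f x) \<omega>"
  unfolding trunc_fourier_def fourier_def set_lebesgue_integral_def
  by (simp add: scaleR_conv_of_real mult.assoc of_real_indicator)

lemma bounded_AE_cont_diff:
  assumes "bounded_AE_cont f" "bounded_AE_cont g"
  shows "bounded_AE_cont (\<lambda>x. f x - g x)"
proof -
  have "AE x in lborel. isCont (\<lambda>x. f x - g x) x"
    using assms unfolding bounded_AE_cont_def by (auto elim!: eventually_elim2)
  moreover have "bounded (range (\<lambda>x. f x - g x))"
    using assms unfolding bounded_AE_cont_def by (intro bounded_minus_comp) auto
  ultimately show ?thesis
    using assms unfolding bounded_AE_cont_def by auto
qed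

lemma isCont_indicator_AE:
  "AE x in lborel. isCont (indicator {a..b} :: real \<Rightarrow> complex) x"
proof -
  have "AE x in lborel. x \<noteq> a \<and> x \<noteq> b"
    using AE_lborel_singleton[of a] AE_lborel_singleton[of b] by auto
  then show ?thesis
  proof eventually_elim
    fix x assume "x \<noteq> a \<and> x \<noteq> b"
    then have "isCont (\<lambda>x. complex_of_real (indicator {a..b} x)) x"
      by (intro continuous_intros isCont_indicator[THEN iffD2]) (auto simp: frontier_cbox[where 'a=real, simplified])
    then show "isCont (indicator {a..b} :: real \<Rightarrow> complex) x"
      by (simp add: of_real_indicator[abs_def])
  qed
qed

lemma bounded_AE_cont_trunc:
  assumes f: "bounded_AE_cont f"
  shows "bounded_AE_cont (\<lambda>x. indicator {a..b} x * f x)" "integrable lborel (\<lambda>x. indicator {a..b} x * f x)"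
proof -
  have [measurable]: "f \<in> borel_measurable borel" using f by (simp add: bounded_AE_cont_def)
  obtain B where B: "\<And>x. norm (f x) \<le> B" using f by (auto simp: bounded_AE_cont_def bounded_iff)
  have "AE x in lborel. isCont (\<lambda>x. indicator {a..b} x * f x) x"
    using f isCont_indicator_AE[of a b] unfolding bounded_AE_cont_def
    by (auto elim!: eventually_elim2)
  moreover have "bounded (range (\<lambda>x. indicator {a..b} x * f x))"
    using B by (intro boundedI[of _ B]) (auto simp: indicator_def norm_mult intro: order_trans[OF norm_ge_zero, OF B])
  ultimately show "bounded_AE_cont (\<lambda>x. indicator {a..b} x * f x)"
    by (simp add: bounded_AE_cont_def)
  show "integrable lborel (\<lambda>x. indicator {a..b} x * f x)"
  proof (rule Bochner_Integration.integrable_bound)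
    show "integrable lborel (\<lambda>x. indicator {a..b} x * B)"
      by (intro integrable_mult_left integrable_real_indicator) (auto simp: emeasure_lborel_Icc_eq)
    show "AE x in lborel. norm (indicator {a..b} x * f x) \<le> norm (indicator {a..b} x * B)"
      using B by (auto simp: indicator_def intro!: AE_I2 order_trans[OF _ abs_ge_self])
  qed simp
qed

lemma l2sq_fourier:
  assumes "bounded_AE_cont g" "integrable lborel g"
  shows "l2sq (\<lambda>\<omega>. of_real (1 / sqrt (2 * pi)) * fourier g \<omega>) = l2sq g"
proof -
  have [measurable]: "g \<in> borel_measurable borel" using assms by (simp add: bounded_AE_cont_def)
  obtain B where B: "\<And>x. norm (g x) \<le> B" using assms by (auto simp: bounded_AE_cont_def bounded_iff)
  have "l2sq (\<lambda>\<omega>. of_real (1 / sqrt (2 * pi)) * fourier g \<omega>) = ennreal (1 / (2 * pi)) * l2sq (fourier g)"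
    by (subst nn_integral_cmult[symmetric])
       (auto simp: norm_mult norm_divide power_mult_distrib power_divide simp flip: ennreal_mult)
  also have "\<dots> = ennreal (1 / (2 * pi)) * (ennreal (2 * pi) * l2sq g)"
    using assms by (subst parseval[OF _ B]) (auto simp: bounded_AE_cont_def)
  also have "\<dots> = l2sq g"
    by (simp add: mult.assoc[symmetric] flip: ennreal_mult)
  finally show ?thesis .
qed

lemma fourier_diff:
  assumes "integrable lborel f" "integrable lborel g"
  shows "fourier f \<omega> - fourier g \<omega> = fourier (\<lambda>x. f x - g x) \<omega>"
proof -
  have "integrable lborel (\<lambda>x. f x * exp (- \<i> * of_real (\<omega> * x)))" if f: "integrable lborel f" for f :: "real \<Rightarrow> complex"
  proof -
    have [measurable]: "f \<in> borel_measurable borel" using f by simp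
    show ?thesis by (rule Bochner_Integration.integrable_bound[OF f]) (auto simp: norm_mult)
  qed
  from this[OF assms(1)] this[OF assms(2)] show ?thesis
    unfolding fourier_def left_diff_distrib by (rule Bochner_Integration.integral_diff[symmetric])
qed

text \<open>Truncations are integrable, so the difference of the transforms is the transform of the
  difference and Parseval applies. One function with two cutoffs gives the Cauchy property; two
  functions with one cutoff give injectivity.\<close>

lemma l2sq_trunc_fourier_diff:
  assumes f: "bounded_AE_cont f" and g: "bounded_AE_cont g"
  shows "l2sq (\<lambda>\<omega>. trunc_fourier S f \<omega> - trunc_fourier T g \<omega>)
     = l2sq (\<lambda>x. indicator {-S..S} x * f x - indicator {-T..T} x * g x)"
proof -
  note i = bounded_AE_cont_trunc[OF f, of "-S" S] bounded_AE_cont_trunc[OF g, of "-T" T]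
  have "l2sq (\<lambda>\<omega>. trunc_fourier S f \<omega> - trunc_fourier T g \<omega>)
     = l2sq (\<lambda>\<omega>. of_real (1 / sqrt (2 * pi)) * fourier (\<lambda>x. indicator {-S..S} x * f x - indicator {-T..T} x * g x) \<omega>)"
    using i by (simp add: trunc_fourier_eq fourier_diff[symmetric] right_diff_distrib)
  also have "\<dots> = l2sq (\<lambda>x. indicator {-S..S} x * f x - indicator {-T..T} x * g x)"
    using i by (intro l2sq_fourier bounded_AE_cont_diff Bochner_Integration.integrable_diff)
  finally show ?thesis .
qed

lemma l2sq_tail_tendsto_0:
  assumes [measurable]: "f \<in> borel_measurable borel" and fin: "l2sq f < \<infinity>"
  shows "((\<lambda>T. l2sq (\<lambda>x. f x - indicator {-T..T} x * f x)) \<longlongrightarrow> 0) at_top"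
proof -
  have i: "integrable lborel (\<lambda>x. (cmod (f x))\<^sup>2)"
    using fin by (intro integrableI_bounded) auto
  have "((\<lambda>T. \<integral>x. (cmod (f x - indicator {-T..T} x * f x))\<^sup>2 \<partial>lborel) \<longlongrightarrow> (\<integral>x. 0 \<partial>(lborel :: real measure))) at_top"
  proof (rule integral_dominated_convergence_at_top[where w="\<lambda>x. (cmod (f x))\<^sup>2"])
    show "AE x in lborel. ((\<lambda>T. (cmod (f x - indicator {-T..T} x * f x))\<^sup>2) \<longlongrightarrow> 0) at_top"
    proof (intro AE_I2 tendsto_eventually)
      fix x show "\<forall>\<^sub>F T in at_top. (cmod (f x - indicator {-T..T} x * f x))\<^sup>2 = 0"
        using eventually_ge_at_top[of "\<bar>x\<bar>"] by eventually_elim (auto simp: indicator_def)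
    qed
    show "\<forall>\<^sub>F T in at_top. AE x in lborel. norm ((cmod (f x - indicator {-T..T} x * f x))\<^sup>2) \<le> (cmod (f x))\<^sup>2"
      by (auto simp: indicator_def)
  qed (use i in auto)
  then have "((\<lambda>T. ennreal (\<integral>x. (cmod (f x - indicator {-T..T} x * f x))\<^sup>2 \<partial>lborel)) \<longlongrightarrow> ennreal 0) at_top"
    by (intro tendsto_intros) simp
  moreover have "ennreal (\<integral>x. (cmod (f x - indicator {-T..T} x * f x))\<^sup>2 \<partial>lborel) = l2sq (\<lambda>x. f x - indicator {-T..T} x * f x)" for T
  proof (rule nn_integral_eq_integral[symmetric])
    show "integrable lborel (\<lambda>x. (cmod (f x - indicator {-T..T} x * f x))\<^sup>2)"
      by (rule Bochner_Integration.integrable_bound[OF i]) (auto simp: indicator_def)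
  qed simp
  ultimately show ?thesis by simp
qed

lemma trunc_fourier_measurable[measurable]:
  "f \<in> borel_measurable borel \<Longrightarrow> trunc_fourier T f \<in> borel_measurable borel"
  unfolding trunc_fourier_eq[abs_def] by measurable

lemma l2sq_trunc_fourier_diff_le:
  assumes f: "bounded_AE_cont f" and "S \<le> T"
  shows "l2sq (\<lambda>\<omega>. trunc_fourier T f \<omega> - trunc_fourier S f \<omega>) \<le> l2sq (\<lambda>x. f x - indicator {-S..S} x * f x)"
  unfolding l2sq_trunc_fourier_diff[OF f f]
  using \<open>S \<le> T\<close> by (intro nn_integral_mono ennreal_leI power_mono) (auto simp: indicator_def)

text \<open>Transforms at integer cutoffs are Cauchy in mean because tails of \<open>f\<close>
  vanish, and a subsequence converges almost everywhere to some \<open>h\<close>. Fatou then bounds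
  the distance from \<open>h\<close> to the transform at any real cutoff by a tail, which is the
  convergence along \<open>at_top\<close> in \<open>L2_fourier\<close>.\<close>

lemma L2_fourier_exists:
  assumes f: "bounded_AE_cont f" and fin: "l2sq f < \<infinity>"
  shows "\<exists>h. h \<in> L2_fourier f"
proof -
  have [measurable]: "f \<in> borel_measurable borel" using f by (simp add: bounded_AE_cont_def)
  let ?e = "\<lambda>T. l2sq (\<lambda>x. f x - indicator {-T..T} x * f x)"
  note e = l2sq_tail_tendsto_0[OF _ fin, simplified]
  have fin_trunc: "l2sq (trunc_fourier T f) < \<infinity>" for T
  proof -
    have "l2sq (trunc_fourier T f) = l2sq (\<lambda>x. indicator {-T..T} x * f x)"
      using bounded_AE_cont_trunc[OF f] by (simp only: trunc_fourier_eq[abs_def] l2sq_fourier)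
    also have "\<dots> \<le> l2sq f"
      by (intro nn_integral_mono ennreal_leI power_mono) (auto simp: indicator_def)
    finally show ?thesis using fin by (rule le_less_trans)
  qed
  obtain r h where r: "strict_mono r" and h[measurable]: "h \<in> borel_measurable borel"
    and lim: "AE x in lborel. (\<lambda>i. trunc_fourier (real (r i)) f x) \<longlonglongrightarrow> h x"
  proof (rule L2_Cauchy_AE_convergent_subseq[of "\<lambda>n. trunc_fourier (real n) f"])
    fix \<epsilon> :: real assume "\<epsilon> > 0"
    then have "\<forall>\<^sub>F T in at_top. ?e T < ennreal \<epsilon>"
      using e by (intro order_tendstoD) auto
    then have "\<forall>\<^sub>F n in sequentially. ?e (real n) < ennreal \<epsilon>"
      by (rule eventually_compose_filterlim[OF _ filterlim_real_sequentially])
    then obtain N where N: "\<And>n. n \<ge> N \<Longrightarrow> ?e (real n) < ennreal \<epsilon>"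
      by (auto simp: eventually_sequentially)
    have "l2sq (\<lambda>x. trunc_fourier (real i) f x - trunc_fourier (real j) f x) < ennreal \<epsilon>" if "i \<ge> N" "j \<ge> N" for i j
    proof (cases "j \<le> i")
      case True
      then show ?thesis
        using l2sq_trunc_fourier_diff_le[OF f, of "real j" "real i"] N[OF that(2)] by (auto intro: le_less_trans)
    next
      case False
      then show ?thesis
        using l2sq_trunc_fourier_diff_le[OF f, of "real i" "real j"] N[OF that(1)]
        by (subst norm_minus_commute) (auto intro: le_less_trans)
    qed
    then show "\<exists>N. \<forall>i\<ge>N. \<forall>j\<ge>N. l2sq (\<lambda>x. trunc_fourier (real i) f x - trunc_fourier (real j) f x) < ennreal \<epsilon>"
      by blast
  qed (use fin_trunc in auto)
  have le: "l2sq (\<lambda>x. h x - trunc_fourier T f x) \<le> ?e T" for T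
  proof (rule l2sq_Fatou[OF _ h _ lim])
    have "\<forall>\<^sub>F i in sequentially. T \<le> real (r i)"
      using filterlim_compose[OF filterlim_real_sequentially filterlim_subseq[OF r]]
      by (auto simp: filterlim_at_top)
    then show "\<forall>\<^sub>F i in sequentially. l2sq (\<lambda>x. trunc_fourier (real (r i)) f x - trunc_fourier T f x) \<le> ?e T"
      by eventually_elim (rule l2sq_trunc_fourier_diff_le[OF f])
  qed simp_all
  have lim0: "((\<lambda>T. l2sq (\<lambda>x. h x - trunc_fourier T f x)) \<longlongrightarrow> 0) at_top"
    by (rule tendsto_sandwich[OF _ _ tendsto_const e]) (auto simp: le)
  \<comment> \<open>The transform at cutoff 0 serves as a reference: its norm is finite and so is
    its distance to \<open>h\<close>.\<close>
  have "l2sq h < \<infinity>"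
  proof -
    have "?e 0 \<le> l2sq f"
      by (intro nn_integral_mono ennreal_leI power_mono) (auto simp: indicator_def)
    with le[of 0] fin have "l2sq (\<lambda>x. trunc_fourier 0 f x - h x) < \<infinity>"
      by (subst norm_minus_commute) (auto intro: le_less_trans)
    with fin_trunc[of 0] have "2 * l2sq (\<lambda>x. trunc_fourier 0 f x - h x) + 2 * l2sq (\<lambda>x. trunc_fourier 0 f x - 0) < \<infinity>"
      by (simp add: ennreal_mult_less_top)
    with l2sq_diff_le[of h "\<lambda>_. 0" "trunc_fourier 0 f"] show ?thesis
      by (auto intro: le_less_trans)
  qed
  with lim0 fin have "h \<in> L2_fourier f"
    by (simp add: L2_fourier_def L2_fun_def)
  then show ?thesis by blast
qed

text \<open>Limits in the mean are unique up to null sets, and changing \<open>h\<close> on a null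
  set alters no distance. This brings the set-valued transform into the form
  \<open>ae_class h\<close> in which \<open>U_spec\<close> takes its arguments.\<close>

lemma L2_fourier_eq_ae_class:
  assumes h: "h \<in> L2_fourier f"
  shows "L2_fourier f = ae_class h"
proof (intro set_eqI iffI)
  have [measurable]: "h \<in> borel_measurable borel" "f \<in> borel_measurable borel"
    and lh: "((\<lambda>T. l2sq (\<lambda>x. h x - trunc_fourier T f x)) \<longlongrightarrow> 0) at_top"
    and fin: "l2sq h < \<infinity>" and f: "f \<in> L2_fun"
    using h by (auto simp: L2_fourier_def L2_fun_def)
  fix g
  {
    assume g: "g \<in> L2_fourier f"
    then have [measurable]: "g \<in> borel_measurable borel"
      and lg: "((\<lambda>T. l2sq (\<lambda>x. g x - trunc_fourier T f x)) \<longlongrightarrow> 0) at_top"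
      by (auto simp: L2_fourier_def L2_fun_def)
    have "((\<lambda>T. 2 * l2sq (\<lambda>x. g x - trunc_fourier T f x) + 2 * l2sq (\<lambda>x. h x - trunc_fourier T f x)) \<longlongrightarrow> 2 * 0 + 2 * 0) at_top"
      by (intro tendsto_add ennreal_tendsto_cmult lg lh) auto
    moreover have "l2sq (\<lambda>x. g x - h x) \<le> 2 * l2sq (\<lambda>x. g x - trunc_fourier T f x) + 2 * l2sq (\<lambda>x. h x - trunc_fourier T f x)" for T
      using l2sq_diff_le[of g h "trunc_fourier T f"] by (simp add: norm_minus_commute)
    ultimately have "l2sq (\<lambda>x. g x - h x) \<le> 2 * 0 + 2 * 0"
      by (intro tendsto_lowerbound[where F=at_top]) (auto intro: always_eventually)
    then have "AE x in lborel. g x = h x"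
      by (subst l2sq_eq_0_iff[symmetric]) auto
    then show "g \<in> ae_class h" by (simp add: ae_class_def)
  next
    assume g: "g \<in> ae_class h"
    then have [measurable]: "g \<in> borel_measurable borel" and ae: "AE x in lborel. g x = h x"
      by (auto simp: ae_class_def)
    have "l2sq (\<lambda>x. g x - trunc_fourier T f x) = l2sq (\<lambda>x. h x - trunc_fourier T f x)" for T
      using ae by (intro nn_integral_cong_AE) auto
    moreover have "l2sq g = l2sq h"
      using ae by (intro nn_integral_cong_AE) auto
    ultimately show "g \<in> L2_fourier f"
      using lh fin f by (simp add: L2_fourier_def L2_fun_def)
  }
qed

text \<open>On the window \<open>{-S..S}\<close> the distance of \<open>f\<close> and
  \<open>g\<close> is at most that on \<open>{-T..T}\<close>, which Parseval identifies with the
  distance of the truncated transforms. Both transforms approach \<open>h\<close> as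
  \<open>T\<close> grows, so the window carries distance 0; countably many windows cover the
  line.\<close>

lemma L2_fourier_inj:
  assumes f: "bounded_AE_cont f" and g: "bounded_AE_cont g"
    and hf: "h \<in> L2_fourier f" and hg: "h \<in> L2_fourier g"
  shows "AE x in lborel. f x = g x"
proof -
  have [measurable]: "h \<in> borel_measurable borel" "f \<in> borel_measurable borel" "g \<in> borel_measurable borel"
    and lf: "((\<lambda>T. l2sq (\<lambda>x. h x - trunc_fourier T f x)) \<longlongrightarrow> 0) at_top"
    and lg: "((\<lambda>T. l2sq (\<lambda>x. h x - trunc_fourier T g x)) \<longlongrightarrow> 0) at_top"
    using hf hg by (auto simp: L2_fourier_def L2_fun_def)
  have "AE x in lborel. indicator {-S..S} x * f x = indicator {-S..S} x * g x" for S :: real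
  proof -
    have "((\<lambda>T. 2 * l2sq (\<lambda>x. h x - trunc_fourier T f x) + 2 * l2sq (\<lambda>x. h x - trunc_fourier T g x)) \<longlongrightarrow> 2 * 0 + 2 * 0) at_top"
      by (intro tendsto_add ennreal_tendsto_cmult lg lf) auto
    moreover have "l2sq (\<lambda>x. indicator {-S..S} x * f x - indicator {-S..S} x * g x)
        \<le> 2 * l2sq (\<lambda>x. h x - trunc_fourier T f x) + 2 * l2sq (\<lambda>x. h x - trunc_fourier T g x)" if "S \<le> T" for T
    proof -
      have "l2sq (\<lambda>x. indicator {-S..S} x * f x - indicator {-S..S} x * g x)
         \<le> l2sq (\<lambda>x. indicator {-T..T} x * f x - indicator {-T..T} x * g x)"
        using that by (intro nn_integral_mono ennreal_leI power_mono) (auto simp: indicator_def)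
      also have "\<dots> = l2sq (\<lambda>\<omega>. trunc_fourier T f \<omega> - trunc_fourier T g \<omega>)"
        by (rule l2sq_trunc_fourier_diff[OF f g, symmetric])
      also have "\<dots> \<le> 2 * l2sq (\<lambda>x. h x - trunc_fourier T f x) + 2 * l2sq (\<lambda>x. h x - trunc_fourier T g x)"
        by (rule l2sq_diff_le) auto
      finally show ?thesis .
    qed
    ultimately have "l2sq (\<lambda>x. indicator {-S..S} x * f x - indicator {-S..S} x * g x) \<le> 2 * 0 + 2 * 0"
      by (intro tendsto_lowerbound[where F=at_top]) (auto intro: eventually_at_top_linorderI[of S])
    then show ?thesis
      by (subst l2sq_eq_0_iff[symmetric]) auto
  qed
  then have "AE x in lborel. \<forall>n::nat. indicator {- real n..real n} x * f x = indicator {- real n..real n} x * g x"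
    unfolding AE_all_countable by blast
  then show ?thesis
  proof eventually_elim
    fix x assume *: "\<forall>n::nat. indicator {- real n..real n} x * f x = indicator {- real n..real n} x * g x"
    obtain n :: nat where "\<bar>x\<bar> \<le> real n" using real_arch_simple by blast
    then show "f x = g x" using *[rule_format, of n] by (auto simp: indicator_def)
  qed
qed

section \<open>Injectivity of the spectral map on CDFs\<close>

text \<open>At a point of disagreement, right continuity keeps the difference nonzero on an interval
  to the right, and such an interval has positive length.\<close>

lemma right_cont_AE_eq:
  fixes f g :: "real \<Rightarrow> real"
  assumes ae: "AE x in lborel. f x = g x"
    and "\<And>a. continuous (at_right a) f" "\<And>a. continuous (at_right a) g"
  shows "f = g"
proof (rule ccontr)
  assume "f \<noteq> g"
  then obtain a where "f a \<noteq> g a" by auto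
  moreover have "((\<lambda>x. f x - g x) \<longlongrightarrow> f a - g a) (at_right a)"
    using assms(2,3)[of a] by (auto simp: continuous_within intro!: tendsto_intros)
  ultimately have "\<forall>\<^sub>F x in at_right a. f x - g x \<noteq> 0"
    by (intro tendsto_imp_eventually_ne) auto
  then obtain b where "b > a" and b: "\<And>x. a < x \<Longrightarrow> x < b \<Longrightarrow> f x \<noteq> g x"
    by (auto simp: eventually_at_right_field)
  from ae have "AE x in lborel. x \<notin> {a<..<b}"
    by eventually_elim (use b in auto)
  then have "emeasure lborel {a<..<b} = 0"
    by (subst (asm) AE_iff_null_sets[symmetric]) auto
  with \<open>b > a\<close> show False by simp
qed

text \<open>A monotone function has only countably many discontinuities, and centring adds at most
  the jump at 0.\<close>

lemma bounded_AE_cont_centre_cdf: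
  assumes "real_distribution N"
  shows "bounded_AE_cont (\<lambda>x. complex_of_real (centre (cdf N) x))"
proof -
  interpret real_distribution N by fact
  have "mono (cdf N)" by (intro monoI cdf_nondecreasing)
  then have "AE x in lborel. isCont (cdf N) x"
    by (intro AE_I'[OF countable_imp_null_set_lborel[OF mono_ctble_discont]]) auto
  moreover have "AE x in lborel. x \<noteq> (0::real)"
    by (rule AE_lborel_singleton)
  ultimately have "AE x in lborel. isCont (\<lambda>x. complex_of_real (centre (cdf N) x)) x"
  proof eventually_elim
    fix x :: real assume x: "x \<noteq> 0" "isCont (cdf N) x"
    have "x \<notin> frontier {0::real..}" using x(1) by (simp add: frontier_def)
    then show "isCont (\<lambda>x. complex_of_real (centre (cdf N) x)) x"
      unfolding centre_def using x(2) by (intro continuous_intros isCont_indicator[THEN iffD2])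
  qed
  moreover have "bounded (range (\<lambda>x. complex_of_real (centre (cdf N) x)))"
  proof (rule boundedI[of _ 1], clarify)
    fix x show "norm (complex_of_real (centre (cdf N) x)) \<le> 1"
      unfolding norm_of_real centre_def
      using cdf_nonneg[of x] cdf_bounded_prob[of x] by (simp add: indicator_def abs_le_iff)
  qed
  moreover have "cdf N \<in> borel_measurable borel"
    by (rule borel_measurable_mono) fact
  ultimately show ?thesis
    unfolding bounded_AE_cont_def by (auto simp: centre_def)
qed

text \<open>\<open>U_spec\<close> is specified on \<open>H_cdf\<close> only. The weight
  \<open>\<omega>\<^sup>2 / (\<omega>\<^sup>2 + \<epsilon>)\<close> is at most 1, so every square
  integrable transform lies in this domain and the multiplier formula applies.\<close>

lemma V_spec_eq:
  assumes "\<epsilon> > 0" and h: "h \<in> L2_fourier (\<lambda>x. complex_of_real (centre F x))"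
  shows "V_spec \<epsilon> F = ae_class (\<lambda>\<omega>. - of_real (sqrt (2 * pi)) * \<i> * of_real \<omega> * cnj (h \<omega>))"
proof -
  have hb: "h \<in> borel_measurable borel" and fin: "l2sq h < \<infinity>"
    using h by (auto simp: L2_fourier_def L2_fun_def)
  have "(\<integral>\<^sup>+\<omega>. ennreal (\<omega>\<^sup>2 / (\<omega>\<^sup>2 + \<epsilon>) * (cmod (h \<omega>))\<^sup>2) \<partial>lborel) \<le> l2sq h"
    using assms(1) by (intro nn_integral_mono ennreal_leI mult_left_le_one_le) (auto simp: divide_le_eq add_nonneg_pos)
  with fin hb have "ae_class h \<in> H_cdf \<epsilon>"
    unfolding H_cdf_def by (auto intro: le_less_trans)
  then show ?thesis
    unfolding V_spec_def L2_fourier_eq_ae_class[OF h] by (rule U_spec_ae_class[OF hb])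
qed

lemma V_spec_inj_on:
  assumes \<epsilon>: "\<epsilon> > 0"
  shows "inj_on (V_spec \<epsilon>) Gamma_F"
proof (rule inj_onI)
  fix F G assume "F \<in> Gamma_F" "G \<in> Gamma_F" and eq: "V_spec \<epsilon> F = V_spec \<epsilon> G"
  then obtain N K where N: "real_distribution N" "F = cdf N" and K: "real_distribution K" "G = cdf K"
    and fin: "(\<integral>\<^sup>+x. ennreal ((centre F x)\<^sup>2) \<partial>lborel) < \<infinity>" "(\<integral>\<^sup>+x. ennreal ((centre G x)\<^sup>2) \<partial>lborel) < \<infinity>"
    by (auto simp: Gamma_F_def)
  let ?F = "\<lambda>x. complex_of_real (centre F x)" and ?G = "\<lambda>x. complex_of_real (centre G x)"
  have F: "bounded_AE_cont ?F" and G: "bounded_AE_cont ?G"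
    using N K by (auto intro: bounded_AE_cont_centre_cdf)
  obtain h k where h: "h \<in> L2_fourier ?F" and k: "k \<in> L2_fourier ?G"
    using L2_fourier_exists[OF F] L2_fourier_exists[OF G] fin by auto
  have [measurable]: "h \<in> borel_measurable borel" "k \<in> borel_measurable borel"
    using h k by (auto simp: L2_fourier_def L2_fun_def)
  let ?u = "\<lambda>h \<omega>. - of_real (sqrt (2 * pi)) * \<i> * of_real \<omega> * cnj (h \<omega>)"
  have "?u h \<in> borel_measurable borel"
    by measurable
  then have "?u h \<in> ae_class (?u k)"
    using ae_class_self[of "?u h"] eq unfolding V_spec_eq[OF \<epsilon> h] V_spec_eq[OF \<epsilon> k] by simp
  then have "AE \<omega> in lborel. ?u h \<omega> = ?u k \<omega>"
    by (simp add: ae_class_def)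
  \<comment> \<open>The multiplier vanishes only at 0, so it cancels off a null set.\<close>
  moreover have "AE \<omega> in lborel. \<omega> \<noteq> (0::real)"
    by (rule AE_lborel_singleton)
  ultimately have "AE \<omega> in lborel. h \<omega> = k \<omega>"
    by eventually_elim simp
  then have "h \<in> L2_fourier ?G"
    by (simp add: L2_fourier_eq_ae_class[OF k] ae_class_def)
  with L2_fourier_inj[OF F G h] have "AE x in lborel. F x = G x"
    by (simp add: centre_def)
  then show "F = G"
    using N K
    by (intro right_cont_AE_eq) (auto intro!: finite_borel_measure.cdf_is_right_cont real_distribution.finite_borel_measure_M)
qed

lemma V_field_inj_on:
  assumes "\<epsilon> > 0"
  shows "inj_on (V_field M \<epsilon>) (X_cdf M)"
proof (rule inj_onI)
  fix F G assume F: "F \<in> X_cdf M" and G: "G \<in> X_cdf M" and eq: "V_field M \<epsilon> F = V_field M \<epsilon> G"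
  show "F = G"
  proof (rule PiE_ext)
    show "F \<in> space (sa_space M) \<rightarrow>\<^sub>E Gamma_F" "G \<in> space (sa_space M) \<rightarrow>\<^sub>E Gamma_F"
      using F G by (simp_all add: X_cdf_def)
    fix z assume z: "z \<in> space (sa_space M)"
    then have "F z \<in> Gamma_F" "G z \<in> Gamma_F"
      using F G unfolding X_cdf_def by blast+
    moreover have "V_spec \<epsilon> (F z) = V_spec \<epsilon> (G z)"
      using fun_cong[OF eq, of z] z by (simp add: V_field_def)
    ultimately show "F z = G z"
      using V_spec_inj_on[OF assms] by (auto dest: inj_onD)
  qed
qed

section \<open>The law of the state-action chain\<close>

text \<open>Approximating \<open>y\<close> by functions with countably many values reduces the claim
  to measurability at fixed second argument; right continuity passes to the limit.\<close>

lemma measurable_right_cont_compose: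
  fixes F :: "'a \<Rightarrow> real \<Rightarrow> real"
  assumes meas: "\<And>x. (\<lambda>z. F z x) \<in> borel_measurable M"
    and cont: "\<And>z x. z \<in> space M \<Longrightarrow> continuous (at_right x) (F z)"
    and y[measurable]: "y \<in> borel_measurable M"
  shows "(\<lambda>z. F z (y z)) \<in> borel_measurable M"
proof (rule borel_measurable_LIMSEQ_real)
  \<comment> \<open>The floor plus one puts the grid point strictly above \<open>t\<close>, as
    convergence in \<open>at_right\<close> demands.\<close>
  let ?q = "\<lambda>n t. (real_of_int \<lfloor>real (Suc n) * t\<rfloor> + 1) / real (Suc n)"
  show "(\<lambda>z. F z (?q n (y z))) \<in> borel_measurable M" for n
    by (rule measurable_compose_countable[where f="\<lambda>k z. F z ((real_of_int k + 1) / real (Suc n))"]) (use meas in measurable)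
  fix z assume z: "z \<in> space M"
  have gt: "?q n t > t" and le: "?q n t \<le> t + 1 / real (Suc n)" for n t
  proof -
    have "real (Suc n) * t < real_of_int \<lfloor>real (Suc n) * t\<rfloor> + 1" by linarith
    then show "?q n t > t" by (simp only: pos_less_divide_eq[OF of_nat_0_less_iff[THEN iffD2, OF zero_less_Suc]] mult.commute[of t])
    have "real_of_int \<lfloor>real (Suc n) * t\<rfloor> + 1 \<le> real (Suc n) * t + 1" by linarith
    then have "?q n t \<le> (real (Suc n) * t + 1) / real (Suc n)" by (intro divide_right_mono) auto
    then show "?q n t \<le> t + 1 / real (Suc n)" by (simp add: add_divide_distrib del: of_nat_Suc)
  qed
  have "(\<lambda>n. y z + 1 / real (Suc n)) \<longlonglongrightarrow> y z + 0"
    by (intro tendsto_intros LIMSEQ_inverse_real_of_nat[unfolded inverse_eq_divide])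
  then have "(\<lambda>n. y z + 1 / real (Suc n)) \<longlonglongrightarrow> y z" by simp
  then have "(\<lambda>n. ?q n (y z)) \<longlonglongrightarrow> y z"
    by (rule tendsto_sandwich[where f="\<lambda>_. y z", rotated 3]) (auto intro!: always_eventually less_imp_le gt le simp del: of_nat_Suc)
  then have "filterlim (\<lambda>n. ?q n (y z)) (at_right (y z)) sequentially"
    unfolding filterlim_at using gt by (auto intro!: always_eventually simp del: of_nat_Suc simp: less_imp_neq[symmetric])
  with cont[OF z, of "y z"] show "(\<lambda>n. F z (?q n (y z))) \<longlonglongrightarrow> F z (y z)"
    unfolding continuous_within by (rule filterlim_compose)
qed

section \<open>The trajectory law as a kernel and its first-step decomposition\<close>

locale policy_mdp =
  fixes M :: "('s, 'a) mdp" and \<pi> :: "('s, 'a) policy"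
  assumes mdp: "is_discounted_mdp M" and policy: "is_stationary_policy M \<pi>"
begin

abbreviation "S \<equiv> sa_space M"
abbreviation "K \<equiv> sa_kernel M \<pi>"
abbreviation "\<Omega> \<equiv> \<Pi>\<^sub>M i\<in>(UNIV :: nat set). S"
abbreviation "P \<equiv> traj_law M \<pi>"

lemma K_prob[measurable]: "K \<in> S \<rightarrow>\<^sub>M prob_algebra S"
  by (rule measurable_sa_kernel[OF mdp policy])

lemma K_subprob[measurable]: "K \<in> S \<rightarrow>\<^sub>M subprob_algebra S"
  by (rule measurable_prob_algebraD[OF K_prob])

lemma sets_K[measurable_cong]: "z \<in> space S \<Longrightarrow> sets (K z) = sets S"
  and prob_space_K: "z \<in> space S \<Longrightarrow> prob_space (K z)"
  using measurable_space[OF K_prob, of z] by (auto simp: space_prob_algebra)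

lemma space_K: "z \<in> space S \<Longrightarrow> space (K z) = space S"
  by (rule sets_eq_imp_space_eq[OF sets_K])

lemma sets_P[measurable_cong]: "z \<in> space S \<Longrightarrow> sets (P z) = sets \<Omega>"
proof -
  assume "z \<in> space S"
  then interpret IT: Ionescu_Tulcea "traj_kernel M \<pi> z" "\<lambda>_. S"
    by (rule Ionescu_Tulcea_traj_kernel[OF mdp policy])
  show ?thesis unfolding traj_law_def by (rule IT.PF.sets_lim)
qed

lemma space_P: "z \<in> space S \<Longrightarrow> space (P z) = space \<Omega>"
  by (rule sets_eq_imp_space_eq[OF sets_P])

lemma prob_space_P: "z \<in> space S \<Longrightarrow> prob_space (P z)"
  by (rule prob_space_traj_law[OF mdp policy])

text \<open>The marginal of the projective limit on the first coordinates is the finite extension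
  \<open>IT.C\<close>, which grows by one kernel application \<open>IT.eP\<close> at a time.
  Integrating out the last coordinate is thus built into the construction.\<close>

lemma nn_integral_traj_law_Suc:
  assumes z: "z \<in> space S" and f[measurable]: "f \<in> borel_measurable (PiM {0..<Suc n} (\<lambda>_. S))"
  shows "(\<integral>\<^sup>+\<omega>. f (restrict \<omega> {0..<Suc n}) \<partial>P z)
    = (\<integral>\<^sup>+\<omega>. \<integral>\<^sup>+y. f ((restrict \<omega> {0..<n})(n := y)) \<partial>traj_kernel M \<pi> z n (restrict \<omega> {0..<n}) \<partial>P z)"
proof -
  interpret IT: Ionescu_Tulcea "traj_kernel M \<pi> z" "\<lambda>_. S"
    by (rule Ionescu_Tulcea_traj_kernel[OF mdp policy z])
  \<comment> \<open>This is the only point of the empty product and the starting point of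
    \<open>IT.C 0 k\<close>.\<close>
  have [simp]: "(\<lambda>x. undefined) \<in> space (PiM {0..<0::nat} (\<lambda>_. S))" by (simp add: space_PiM)
  have r[measurable]: "(\<lambda>\<omega>. restrict \<omega> {0..<k}) \<in> P z \<rightarrow>\<^sub>M PiM {0..<k} (\<lambda>_. S)" for k
    unfolding measurable_cong_sets[OF sets_P[OF z] refl] by (rule measurable_restrict_subset) simp
  have d: "distr (P z) (PiM {0..<k} (\<lambda>_. S)) (\<lambda>\<omega>. restrict \<omega> {0..<k}) = IT.C 0 k (\<lambda>x. undefined)" for k
  proof (rule measure_eqI)
    show "sets (distr (P z) (PiM {0..<k} (\<lambda>_. S)) (\<lambda>\<omega>. restrict \<omega> {0..<k})) = sets (IT.C 0 k (\<lambda>x. undefined))"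
      by (simp add: IT.sets_C)
    fix A assume "A \<in> sets (distr (P z) (PiM {0..<k} (\<lambda>_. S)) (\<lambda>\<omega>. restrict \<omega> {0..<k}))"
    then have A: "A \<in> sets (PiM {0..<k} (\<lambda>_. S))" by simp
    have "distr (P z) (PiM {0..<k} (\<lambda>_. S)) (\<lambda>\<omega>. restrict \<omega> {0..<k}) = IT.CI {0..<k}"
      unfolding traj_law_def by (rule IT.distr_lim) simp
    with A show "emeasure (distr (P z) (PiM {0..<k} (\<lambda>_. S)) (\<lambda>\<omega>. restrict \<omega> {0..<k})) A = emeasure (IT.C 0 k (\<lambda>x. undefined)) A"
      by (simp add: IT.emeasure_CI[of _ k] prod_emb_id[OF sets.sets_into_space[OF A, unfolded space_PiM]])
  qed
  let ?g = "\<lambda>\<omega>. \<integral>\<^sup>+y. f (fun_upd \<omega> n y) \<partial>traj_kernel M \<pi> z n \<omega>"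
  have sC: "sets (IT.C 0 n (\<lambda>x. undefined)) = sets (PiM {0..<n} (\<lambda>_. S))"
    by (simp add: IT.sets_C)
  have eP: "IT.eP n \<in> IT.C 0 n (\<lambda>x. undefined) \<rightarrow>\<^sub>M subprob_algebra (PiM {0..<Suc n} (\<lambda>_. S))"
    unfolding measurable_cong_sets[OF sC refl] by measurable
  have g: "?g \<omega> = (\<integral>\<^sup>+x. f x \<partial>IT.eP n \<omega>)" if "\<omega> \<in> space (PiM {0..<n} (\<lambda>_. S))" for \<omega>
    using that by (rule IT.nn_integral_eP[symmetric]) measurable
  have gm: "?g \<in> borel_measurable (PiM {0..<n} (\<lambda>_. S))"
    by (subst measurable_cong[OF g]) measurable
  have "(\<integral>\<^sup>+\<omega>. f (restrict \<omega> {0..<Suc n}) \<partial>P z) = (\<integral>\<^sup>+x. f x \<partial>IT.C 0 (Suc n) (\<lambda>x. undefined))"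
    unfolding d[symmetric] by (subst nn_integral_distr) auto
  also have "\<dots> = (\<integral>\<^sup>+\<omega>. \<integral>\<^sup>+x. f x \<partial>IT.eP n \<omega> \<partial>IT.C 0 n (\<lambda>x. undefined))"
    unfolding IT.C.simps using nn_integral_bind[OF f eP] by simp
  also have "\<dots> = (\<integral>\<^sup>+\<omega>. ?g \<omega> \<partial>IT.C 0 n (\<lambda>x. undefined))"
    by (intro nn_integral_cong g[symmetric]) (simp add: IT.space_C)
  also have "\<dots> = (\<integral>\<^sup>+\<omega>. ?g (restrict \<omega> {0..<n}) \<partial>P z)"
    unfolding d[symmetric] by (rule nn_integral_distr[OF r]) (simp add: gm)
  finally show ?thesis .
qed

text \<open>The test function \<open>g\<close> at the last coordinate lets the induction in \<open>cyl_first_step\<close> absorb the last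
  kernel step into \<open>g\<close>.\<close>

definition cyl :: "nat \<Rightarrow> (nat \<Rightarrow> ('s \<times> 'a) set) \<Rightarrow> ('s \<times> 'a \<Rightarrow> ennreal) \<Rightarrow> 's \<times> 'a \<Rightarrow> ennreal" where
  "cyl n A g z = (\<integral>\<^sup>+\<omega>. (\<Prod>i\<le>n. indicator (A i) (\<omega> i)) * g (\<omega> n) \<partial>P z)"

lemma cyl_0:
  assumes z: "z \<in> space S" and [measurable]: "A 0 \<in> sets S" "g \<in> borel_measurable S"
  shows "cyl 0 A g z = indicator (A 0) z * g z"
proof -
  interpret P: prob_space "P z" by (rule prob_space_P[OF z])
  let ?f = "\<lambda>\<omega>. indicator (A 0) (\<omega> 0) * g (\<omega> 0)"
  have "cyl 0 A g z = (\<integral>\<^sup>+\<omega>. ?f (restrict \<omega> {0..<Suc 0}) \<partial>P z)"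
    by (simp add: cyl_def)
  also have "\<dots> = (\<integral>\<^sup>+\<omega>. \<integral>\<^sup>+y. indicator (A 0) y * g y \<partial>return S z \<partial>P z)"
    by (subst nn_integral_traj_law_Suc[OF z]) (simp_all add: traj_kernel_def)
  also have "\<dots> = indicator (A 0) z * g z"
    using z by (simp add: nn_integral_return P.emeasure_space_1)
  finally show ?thesis .
qed

text \<open>Given the earlier coordinates, the last one is drawn from \<open>K (\<omega> n)\<close>.
  The indicators of the earlier coordinates are constant for that inner integral and come out of it,
  which leaves a functional of the same shape.\<close>

lemma cyl_Suc:
  assumes z: "z \<in> space S" and [measurable]: "\<And>i. A i \<in> sets S" "g \<in> borel_measurable S"
  shows "cyl (Suc n) A g z = cyl n A (\<lambda>y. \<integral>\<^sup>+y'. indicator (A (Suc n)) y' * g y' \<partial>K y) z"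
proof -
  let ?f = "\<lambda>\<omega>. (\<Prod>i\<le>Suc n. indicator (A i) (\<omega> i)) * g (\<omega> (Suc n)) :: ennreal"
  have c: "(\<lambda>\<omega>. \<omega> i) \<in> PiM {0..<Suc (Suc n)} (\<lambda>_. S) \<rightarrow>\<^sub>M S" if "i \<le> Suc n" for i
    using that by (intro measurable_component_singleton) auto
  have "cyl (Suc n) A g z = (\<integral>\<^sup>+\<omega>. ?f (restrict \<omega> {0..<Suc (Suc n)}) \<partial>P z)"
    unfolding cyl_def by (intro nn_integral_cong arg_cong2[where f="(*)"] prod.cong) auto
  also have "\<dots> = (\<integral>\<^sup>+\<omega>. \<integral>\<^sup>+y. ?f ((restrict \<omega> {0..<Suc n})(Suc n := y)) \<partial>K (\<omega> n) \<partial>P z)"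
  proof (subst nn_integral_traj_law_Suc[OF z])
    show "?f \<in> borel_measurable (PiM {0..<Suc (Suc n)} (\<lambda>_. S))"
      by (intro borel_measurable_times_ennreal borel_measurable_prod_ennreal measurable_compose[OF c borel_measurable_indicator[OF assms(2)]]
            measurable_compose[OF c assms(3)]) auto
  qed (simp add: traj_kernel_def)
  also have "\<dots> = cyl n A (\<lambda>y. \<integral>\<^sup>+y'. indicator (A (Suc n)) y' * g y' \<partial>K y) z"
    unfolding cyl_def
  proof (intro nn_integral_cong)
    fix \<omega> assume "\<omega> \<in> space (P z)"
    then have \<omega>: "\<omega> n \<in> space S" by (auto simp: space_P[OF z] space_PiM)
    have "(\<integral>\<^sup>+y. ?f ((restrict \<omega> {0..<Suc n})(Suc n := y)) \<partial>K (\<omega> n))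
       = (\<integral>\<^sup>+y. (\<Prod>i\<le>n. indicator (A i) (\<omega> i)) * (indicator (A (Suc n)) y * g y) \<partial>K (\<omega> n))"
      by (intro nn_integral_cong, simp only: prod.atMost_Suc mult.assoc, intro arg_cong2[where f="(*)"] prod.cong refl) auto
    also have "\<dots> = (\<Prod>i\<le>n. indicator (A i) (\<omega> i)) * (\<integral>\<^sup>+y. indicator (A (Suc n)) y * g y \<partial>K (\<omega> n))"
      using \<omega> by (intro nn_integral_cmult) measurable
    finally show "(\<integral>\<^sup>+y. ?f ((restrict \<omega> {0..<Suc n})(Suc n := y)) \<partial>K (\<omega> n))
       = (\<Prod>i\<le>n. indicator (A i) (\<omega> i)) * (\<integral>\<^sup>+y. indicator (A (Suc n)) y * g y \<partial>K (\<omega> n))" .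
  qed
  finally show ?thesis .
qed

lemma measurable_K_step:
  assumes [measurable]: "A \<in> sets S" "g \<in> borel_measurable S"
  shows "(\<lambda>y. \<integral>\<^sup>+y'. indicator A y' * g y' \<partial>K y) \<in> borel_measurable S"
  by measurable

lemma measurable_cyl:
  assumes A[measurable]: "\<And>i. A i \<in> sets S" and "g \<in> borel_measurable S"
  shows "cyl n A g \<in> borel_measurable S"
  using assms(2)
proof (induction n arbitrary: g)
  case 0
  then have [measurable]: "g \<in> borel_measurable S" by simp
  show ?case by (subst measurable_cong[OF cyl_0]) (auto simp: A 0)
next
  case (Suc n)
  then have [measurable]: "g \<in> borel_measurable S" by simp
  show ?case
    by (subst measurable_cong[OF cyl_Suc]) (auto intro!: A Suc measurable_K_step)
qed

text \<open>\<open>cyl_Suc\<close> works at the end of the trajectory, the claim at its beginning.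
  The two do not interfere: the last coordinate is removed on both sides, and the hypothesis is used
  for the changed test function.\<close>

lemma cyl_first_step:
  assumes z: "z \<in> space S" and A[measurable]: "\<And>i. A i \<in> sets S" and "g \<in> borel_measurable S"
  shows "cyl (Suc n) A g z = indicator (A 0) z * (\<integral>\<^sup>+z'. cyl n (\<lambda>i. A (Suc i)) g z' \<partial>K z)"
  using assms(3)
proof (induction n arbitrary: g)
  case 0
  then have [measurable]: "g \<in> borel_measurable S" by simp
  have "(\<integral>\<^sup>+z'. cyl 0 (\<lambda>i. A (Suc i)) g z' \<partial>K z) = (\<integral>\<^sup>+y'. indicator (A (Suc 0)) y' * g y' \<partial>K z)"
    by (intro nn_integral_cong cyl_0) (auto simp: space_K[OF z])
  then show ?case
    by (subst cyl_Suc[OF z]) (auto simp: cyl_0[OF z])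
next
  case (Suc n)
  then have [measurable]: "g \<in> borel_measurable S" by simp
  let ?g = "\<lambda>y. \<integral>\<^sup>+y'. indicator (A (Suc (Suc n))) y' * g y' \<partial>K y"
  have "cyl (Suc (Suc n)) A g z = cyl (Suc n) A ?g z"
    by (rule cyl_Suc[OF z]) auto
  also have "\<dots> = indicator (A 0) z * (\<integral>\<^sup>+z'. cyl n (\<lambda>i. A (Suc i)) ?g z' \<partial>K z)"
    by (rule Suc.IH) measurable
  also have "(\<integral>\<^sup>+z'. cyl n (\<lambda>i. A (Suc i)) ?g z' \<partial>K z) = (\<integral>\<^sup>+z'. cyl (Suc n) (\<lambda>i. A (Suc i)) g z' \<partial>K z)"
    by (intro nn_integral_cong cyl_Suc[symmetric]) (auto simp: space_K[OF z])
  finally show ?case .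
qed

lemma emeasure_P_cylinder:
  assumes z: "z \<in> space S" and A[measurable]: "\<And>i. A i \<in> sets S"
  shows "emeasure (P z) {\<omega>\<in>space \<Omega>. \<forall>i\<le>n. \<omega> i \<in> A i} = cyl n A (\<lambda>_. 1) z"
proof -
  have "cyl n A (\<lambda>_. 1) z = (\<integral>\<^sup>+\<omega>. indicator {\<omega>\<in>space \<Omega>. \<forall>i\<le>n. \<omega> i \<in> A i} \<omega> \<partial>P z)"
    unfolding cyl_def
    by (intro nn_integral_cong) (auto simp: indicator_def space_P[OF z] prod_eq_1_iff)
  also have "\<dots> = emeasure (P z) {\<omega>\<in>space \<Omega>. \<forall>i\<le>n. \<omega> i \<in> A i}"
    using z by (intro nn_integral_indicator) (simp add: sets_P, measurable)
  finally show ?thesis ..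
qed

text \<open>Padding with \<open>space S\<close> turns a finite index set into an initial segment,
  the form that \<open>cyl\<close> handles. Inserting 0 gives \<open>Max\<close> a value when
  \<open>J\<close> is empty.\<close>

lemma prod_emb_eq_cylinder:
  assumes "finite J" "\<And>i. i \<in> J \<Longrightarrow> E i \<in> sets S"
  shows "\<exists>A n. (\<forall>i. A i \<in> sets S) \<and> prod_emb UNIV (\<lambda>_. S) J (Pi\<^sub>E J E) = {\<omega>\<in>space \<Omega>. \<forall>i\<le>n. \<omega> i \<in> A i}"
proof (intro exI conjI allI)
  let ?A = "\<lambda>i. if i \<in> J then E i else space S"
  show "?A i \<in> sets S" for i using assms by auto
  show "prod_emb UNIV (\<lambda>_. S) J (Pi\<^sub>E J E) = {\<omega>\<in>space \<Omega>. \<forall>i\<le>Max (insert 0 J). \<omega> i \<in> ?A i}"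
    using assms(1) by (auto simp: prod_emb_def space_PiM PiE_iff Ball_def)
qed

text \<open>Mixing trajectory laws over the next pair by \<open>bind\<close> presupposes
  measurability in the starting pair. It is checked on the intersection-stable generator of
  cylinders, whose probabilities are values of \<open>cyl\<close>.\<close>

lemma P_prob[measurable]: "P \<in> S \<rightarrow>\<^sub>M prob_algebra \<Omega>"
proof (rule measurable_prob_algebra_generated[OF sets_PiM Int_stable_prod_algebra prod_algebra_sets_into_space])
  fix X assume "X \<in> prod_algebra UNIV (\<lambda>_::nat. S)"
  then obtain J E where "finite J" "\<And>i. i \<in> J \<Longrightarrow> E i \<in> sets S" and X_eq: "X = prod_emb UNIV (\<lambda>_. S) J (Pi\<^sub>E J E)"
    by (elim prod_algebraE) blast
  then obtain n A where A: "\<And>i. A i \<in> sets S" and X: "X = {\<omega>\<in>space \<Omega>. \<forall>i\<le>n. \<omega> i \<in> A i}"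
    using prod_emb_eq_cylinder[of J E] unfolding X_eq by blast
  show "(\<lambda>z. emeasure (P z) X) \<in> borel_measurable S"
    unfolding X by (subst measurable_cong[OF emeasure_P_cylinder]) (auto intro!: A measurable_cyl)
qed (simp_all only: prob_space_P sets_P)

lemma P_subprob[measurable]: "P \<in> S \<rightarrow>\<^sub>M subprob_algebra \<Omega>"
  by (rule measurable_prob_algebraD[OF P_prob])

lemma measurable_case_nat_traj:
  "z \<in> space S \<Longrightarrow> case_nat z \<in> \<Omega> \<rightarrow>\<^sub>M \<Omega>"
  by (rule measurable_case_nat') auto

lemma measurable_prepend_traj_law:
  assumes z: "z \<in> space S"
  shows "(\<lambda>z'. distr (P z') \<Omega> (case_nat z)) \<in> K z \<rightarrow>\<^sub>M subprob_algebra \<Omega>"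
  unfolding measurable_cong_sets[OF sets_K[OF z] refl]
proof (rule measurable_distr2[where M=\<Omega>])
  show "(\<lambda>(z', \<omega>). case_nat z \<omega>) \<in> S \<Otimes>\<^sub>M \<Omega> \<rightarrow>\<^sub>M \<Omega>"
    unfolding case_prod_beta' by (rule measurable_compose[OF measurable_snd measurable_case_nat_traj[OF z]])
qed (rule P_subprob)

text \<open>It suffices to compare cylinders, \<open>P z\<close> being finite. Prepending
  \<open>z\<close> shifts all constraints by one index, so a cylinder splits into a condition on
  \<open>z\<close> and a cylinder for the chain from \<open>z'\<close>;
  \<open>cyl_first_step\<close> evaluates the mixture.\<close>

lemma traj_law_first_step:
  assumes z: "z \<in> space S"
  shows "P z = K z \<bind> (\<lambda>z'. distr (P z') \<Omega> (case_nat z))"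
proof (rule measure_eqI_PiM_infinite[where I="UNIV :: nat set" and M="\<lambda>_. S"])
  have ne: "space (K z) \<noteq> {}" using z by (auto simp: space_K[OF z])
  show "sets (P z) = sets \<Omega>" by (rule sets_P[OF z])
  show "sets (K z \<bind> (\<lambda>z'. distr (P z') \<Omega> (case_nat z))) = sets \<Omega>"
    by (rule sets_bind[OF _ ne]) simp
  show "finite_measure (P z)" using prob_space_P[OF z] by (simp add: prob_space_def)
  fix E :: "nat \<Rightarrow> ('s \<times> 'a) set" and J assume J: "finite J" and E: "\<And>i. i \<in> J \<Longrightarrow> E i \<in> sets S"
  obtain n A where A[measurable]: "\<And>i. A i \<in> sets S"
    and X: "prod_emb UNIV (\<lambda>_. S) J (Pi\<^sub>E J E) = {\<omega>\<in>space \<Omega>. \<forall>i\<le>n. \<omega> i \<in> A i}"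
    using prod_emb_eq_cylinder[of J E, OF J E] by blast
  have X': "{\<omega>\<in>space \<Omega>. \<forall>i\<le>n. \<omega> i \<in> A i} \<in> sets \<Omega>"
    by measurable
  let ?X = "{\<omega>\<in>space \<Omega>. \<forall>i\<le>n. \<omega> i \<in> A i}"
  have "emeasure (K z \<bind> (\<lambda>z'. distr (P z') \<Omega> (case_nat z))) ?X = (\<integral>\<^sup>+z'. emeasure (distr (P z') \<Omega> (case_nat z)) ?X \<partial>K z)"
    by (rule emeasure_bind[OF ne measurable_prepend_traj_law[OF z] X'])
  also have "\<dots> = (\<integral>\<^sup>+z'. indicator (A 0) z * emeasure (P z') {\<omega>\<in>space \<Omega>. \<forall>i<n. \<omega> i \<in> A (Suc i)} \<partial>K z)"
  proof (intro nn_integral_cong)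
    fix z' assume "z' \<in> space (K z)"
    then have z': "z' \<in> space S" by (simp add: space_K[OF z])
    have "emeasure (distr (P z') \<Omega> (case_nat z)) ?X = emeasure (P z') (case_nat z -` ?X \<inter> space (P z'))"
      using X' by (intro emeasure_distr) (simp_all add: measurable_cong_sets[OF sets_P[OF z'] refl] measurable_case_nat_traj[OF z])
    also have "case_nat z -` ?X \<inter> space (P z') = (if z \<in> A 0 then {\<omega>\<in>space \<Omega>. \<forall>i<n. \<omega> i \<in> A (Suc i)} else {})"
    proof -
      have "(\<forall>i\<le>n. case_nat z \<omega> i \<in> A i) \<longleftrightarrow> z \<in> A 0 \<and> (\<forall>i<n. \<omega> i \<in> A (Suc i))" for \<omega> :: "nat \<Rightarrow> 's \<times> 'a"
        unfolding less_Suc_eq_le[symmetric] All_less_Suc2 by simp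
      moreover have "case_nat z \<omega> \<in> space \<Omega>" if "\<omega> \<in> space \<Omega>" for \<omega>
        using measurable_space[OF measurable_case_nat_traj[OF z] that] .
      ultimately show ?thesis by (auto simp: space_P[OF z'])
    qed
    finally show "emeasure (distr (P z') \<Omega> (case_nat z)) ?X = indicator (A 0) z * emeasure (P z') {\<omega>\<in>space \<Omega>. \<forall>i<n. \<omega> i \<in> A (Suc i)}"
      by simp
  qed
  also have "\<dots> = emeasure (P z) ?X"
  \<comment> \<open>For \<open>n = 0\<close> the shifted trajectory is unconstrained and contributes
    its total mass 1; otherwise its constraints run over the indices up to
    \<open>n - 1\<close>.\<close>
  proof (cases n)
    case 0
    have "(\<integral>\<^sup>+z'. indicator (A 0) z * emeasure (P z') {\<omega>\<in>space \<Omega>. \<forall>i<n. \<omega> i \<in> A (Suc i)} \<partial>K z) = (\<integral>\<^sup>+z'. indicator (A 0) z \<partial>K z)"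
    proof (intro nn_integral_cong)
      fix z' assume "z' \<in> space (K z)"
      then have z': "z' \<in> space S" by (simp add: space_K[OF z])
      show "indicator (A 0) z * emeasure (P z') {\<omega>\<in>space \<Omega>. \<forall>i<n. \<omega> i \<in> A (Suc i)} = (indicator (A 0) z :: ennreal)"
        using prob_space.emeasure_space_1[OF prob_space_P[OF z']] 0 by (simp add: space_P[OF z'])
    qed
    also have "\<dots> = indicator (A 0) z"
      using prob_space.emeasure_space_1[OF prob_space_K[OF z]] by simp
    also have "\<dots> = emeasure (P z) ?X"
      unfolding emeasure_P_cylinder[OF z A] 0 by (subst cyl_0[OF z]) auto
    finally show ?thesis .
  next
    case (Suc m)
    have *: "emeasure (P z') {\<omega>\<in>space \<Omega>. \<forall>i<n. \<omega> i \<in> A (Suc i)} = cyl m (\<lambda>i. A (Suc i)) (\<lambda>_. 1) z'" if "z' \<in> space S" for z'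
      unfolding Suc less_Suc_eq_le by (rule emeasure_P_cylinder[OF that]) auto
    have [measurable]: "cyl m (\<lambda>i. A (Suc i)) (\<lambda>_. 1) \<in> borel_measurable S"
      by (rule measurable_cyl) auto
    have "(\<integral>\<^sup>+z'. indicator (A 0) z * emeasure (P z') {\<omega>\<in>space \<Omega>. \<forall>i<n. \<omega> i \<in> A (Suc i)} \<partial>K z)
       = (\<integral>\<^sup>+z'. indicator (A 0) z * cyl m (\<lambda>i. A (Suc i)) (\<lambda>_. 1) z' \<partial>K z)"
      by (intro nn_integral_cong) (simp add: * space_K[OF z])
    also have "\<dots> = indicator (A 0) z * (\<integral>\<^sup>+z'. cyl m (\<lambda>i. A (Suc i)) (\<lambda>_. 1) z' \<partial>K z)"
      using z by (intro nn_integral_cmult) measurable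
    also have "\<dots> = cyl n A (\<lambda>_. 1) z"
      unfolding Suc by (rule cyl_first_step[OF z A, symmetric]) simp
    also have "\<dots> = emeasure (P z) ?X"
      by (rule emeasure_P_cylinder[OF z A, symmetric])
    finally show ?thesis .
  qed
  finally show "emeasure (P z) (prod_emb UNIV (\<lambda>_. S) J (Pi\<^sub>E J E))
     = emeasure (K z \<bind> (\<lambda>z'. distr (P z') \<Omega> (case_nat z))) (prod_emb UNIV (\<lambda>_. S) J (Pi\<^sub>E J E))"
    unfolding X ..
qed


lemma AE_P_initial:
  assumes z: "z \<in> space S" and "A \<in> sets S" "z \<in> A"
  shows "AE \<omega> in P z. \<omega> 0 \<in> A"
proof -
  interpret P: prob_space "P z" by (rule prob_space_P[OF z])
  have "emeasure (P z) {\<omega>\<in>space \<Omega>. \<forall>i\<le>0. \<omega> i \<in> A} = cyl 0 (\<lambda>_. A) (\<lambda>_. 1) z"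
    using assms by (intro emeasure_P_cylinder) auto
  also have "\<dots> = 1"
    using assms by (subst cyl_0) auto
  finally have "P.prob {\<omega>\<in>space \<Omega>. \<omega> 0 \<in> A} = 1"
    by (simp add: measure_def)
  then have "AE \<omega> in P z. \<omega> \<in> {\<omega>\<in>space \<Omega>. \<omega> 0 \<in> A}"
    using P.AE_in_set_eq_1[of "{\<omega>\<in>space \<Omega>. \<omega> 0 \<in> A}"] assms(2)
    by (simp add: sets_P[OF z])
  then show ?thesis by eventually_elim simp
qed

text \<open>The event \<open>\<omega> 0 = z\<close> need not be measurable, as singletons need not
  belong to \<open>sets S\<close>. The level set of a measurable real function through
  \<open>z\<close> is measurable, and equality of values is what the Bellman equation uses.\<close>

lemma AE_P_initial_eq:
  fixes f :: "'s \<times> 'a \<Rightarrow> real"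
  assumes z: "z \<in> space S" and f[measurable]: "f \<in> borel_measurable S"
  shows "AE \<omega> in P z. f (\<omega> 0) = f z"
proof -
  have "AE \<omega> in P z. \<omega> 0 \<in> {y \<in> space S. f y = f z}"
    using z by (intro AE_P_initial) auto
  then show ?thesis by eventually_elim simp
qed

lemma nn_integral_traj_law:
  assumes z: "z \<in> space S" and f[measurable]: "f \<in> borel_measurable \<Omega>"
  shows "(\<integral>\<^sup>+\<omega>. f \<omega> \<partial>P z) = (\<integral>\<^sup>+z'. \<integral>\<^sup>+\<omega>. f (case_nat z \<omega>) \<partial>P z' \<partial>K z)"
proof -
  have "(\<integral>\<^sup>+\<omega>. f \<omega> \<partial>P z) = (\<integral>\<^sup>+z'. \<integral>\<^sup>+\<omega>. f \<omega> \<partial>distr (P z') \<Omega> (case_nat z) \<partial>K z)"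
    by (subst traj_law_first_step[OF z]) (rule nn_integral_bind[OF f measurable_prepend_traj_law[OF z]])
  also have "\<dots> = (\<integral>\<^sup>+z'. \<integral>\<^sup>+\<omega>. f (case_nat z \<omega>) \<partial>P z' \<partial>K z)"
  proof (intro nn_integral_cong nn_integral_distr)
    fix z' assume "z' \<in> space (K z)"
    then have z': "z' \<in> space S" by (simp add: space_K[OF z])
    show "case_nat z \<in> P z' \<rightarrow>\<^sub>M \<Omega>"
      unfolding measurable_cong_sets[OF sets_P[OF z'] refl] by (rule measurable_case_nat_traj[OF z])
  qed simp
  finally show ?thesis .
qed

section \<open>The Bellman equation for the soft return\<close>

lemma discount_pos: "0 < discount M" and discount_less_1: "discount M < 1"
  using mdp by (auto simp: is_discounted_mdp_def)

lemma measurable_reward: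
  "(\<lambda>(z, z'). reward M (fst z) (snd z) (fst z')) \<in> borel_measurable (S \<Otimes>\<^sub>M S)"
proof -
  have r: "(\<lambda>((s, a), s'). reward M s a s') \<in> borel_measurable (S \<Otimes>\<^sub>M states M)"
    using mdp by (simp add: is_discounted_mdp_def)
  have "(\<lambda>p. (fst p, fst (snd p))) \<in> S \<Otimes>\<^sub>M S \<rightarrow>\<^sub>M S \<Otimes>\<^sub>M states M"
    by measurable
  from measurable_compose[OF this r] show ?thesis
    by (simp add: case_prod_beta')
qed

lemma measurable_reward_next[measurable]:
  assumes "z \<in> space S"
  shows "(\<lambda>z'. reward M (fst z) (snd z) (fst z')) \<in> borel_measurable S"
  using measurable_Pair2[OF measurable_reward assms] by simp

lemma measurable_pdens[measurable]: "(\<lambda>z. pdens \<pi> (fst z) (snd z)) \<in> borel_measurable S"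
  using policy by (simp add: is_stationary_policy_def case_prod_beta')

lemma measurable_traj_reward[measurable]: "(\<lambda>\<omega>. traj_reward M \<omega> t) \<in> borel_measurable \<Omega>"
proof -
  have "(\<lambda>\<omega>. (\<omega> t, \<omega> (Suc t))) \<in> \<Omega> \<rightarrow>\<^sub>M S \<Otimes>\<^sub>M S"
    by (intro measurable_Pair measurable_component_singleton) auto
  from measurable_compose[OF this measurable_reward] show ?thesis
    by (simp add: traj_reward_def)
qed

lemma measurable_soft_return[measurable]: "soft_return M \<pi> \<alpha> \<in> borel_measurable \<Omega>"
proof -
  have c: "(\<lambda>\<omega>. \<omega> k) \<in> \<Omega> \<rightarrow>\<^sub>M S" for k :: nat
    by (rule measurable_component_singleton) simp
  have [measurable]: "(\<lambda>\<omega>. pdens \<pi> (fst (\<omega> k)) (snd (\<omega> k))) \<in> borel_measurable \<Omega>" for k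
    using measurable_compose[OF c measurable_pdens] .
  have [measurable]: "(\<lambda>\<omega>. soft_return_term M \<pi> \<alpha> \<omega> k) \<in> borel_measurable \<Omega>" for k
    unfolding soft_return_term_def by measurable
  show ?thesis
    unfolding soft_return_def by measurable
qed

text \<open>A soft return omits the log term of its own first action, but that of
  \<open>\<omega> 0\<close> is due once it becomes the second pair. The tail of the prepended series
  is \<open>discount M\<close> times the series of \<open>\<omega>\<close> from index 0, and its
  term 0 supplies the missing log term.\<close>

lemma soft_return_case_nat:
  assumes "summable (\<lambda>k. soft_return_term M \<pi> \<alpha> \<omega> (Suc k))"
  shows "soft_return M \<pi> \<alpha> (case_nat z \<omega>) = reward M (fst z) (snd z) (fst (\<omega> 0))
    + discount M * (soft_return M \<pi> \<alpha> \<omega> - \<alpha> * ln (pdens \<pi> (fst (\<omega> 0)) (snd (\<omega> 0))))"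
proof -
  have "soft_return_term M \<pi> \<alpha> (case_nat z \<omega>) (Suc k) = discount M * soft_return_term M \<pi> \<alpha> \<omega> k" for k
    by (simp add: soft_return_term_def traj_reward_def)
  moreover have "summable (soft_return_term M \<pi> \<alpha> \<omega>)"
    using assms by (simp add: summable_Suc_iff)
  ultimately have "(\<Sum>k. soft_return_term M \<pi> \<alpha> (case_nat z \<omega>) (Suc k))
      = discount M * (soft_return_term M \<pi> \<alpha> \<omega> 0 + (\<Sum>k. soft_return_term M \<pi> \<alpha> \<omega> (Suc k)))"
    by (simp add: suminf_mult suminf_split_head)
  then show ?thesis
    by (simp add: soft_return_def soft_return_term_def traj_reward_def)
qed

text \<open>The threshold obtained by solving the Bellman recursion for the continuation: with next
  pair \<open>z'\<close>, the return from \<open>z\<close> is at most \<open>x\<close> exactly when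
  the continuation return is at most this value.\<close>

definition next_arg :: "real \<Rightarrow> 's \<times> 'a \<Rightarrow> real \<Rightarrow> 's \<times> 'a \<Rightarrow> real" where
  "next_arg \<alpha> z x z' = (x - reward M (fst z) (snd z) (fst z')) / discount M + \<alpha> * ln (pdens \<pi> (fst z') (snd z'))"

lemma measurable_next_arg[measurable]:
  "z \<in> space S \<Longrightarrow> next_arg \<alpha> z x \<in> borel_measurable S"
  unfolding next_arg_def[abs_def] by measurable

lemma T_cdf_eq:
  "z \<in> space S \<Longrightarrow> T_cdf M \<pi> \<alpha> F z x = (\<integral>z'. F z' (next_arg \<alpha> z x z') \<partial>K z)"
  by (cases z) (simp add: T_cdf_def next_arg_def case_prod_beta')

lemma X_cdfD:
  assumes "F \<in> X_cdf M" "z \<in> space S"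
  obtains N where "real_distribution N" "F z = cdf N"
proof -
  have "F \<in> space S \<rightarrow>\<^sub>E Gamma_F" using assms(1) by (simp add: X_cdf_def)
  then have "F z \<in> Gamma_F" using assms(2) by (rule PiE_mem)
  then show thesis using that by (auto simp: Gamma_F_def)
qed

lemma
  assumes "F \<in> X_cdf M" "z \<in> space S"
  shows X_cdf_right_cont: "continuous (at_right x) (F z)"
    and X_cdf_nonneg: "0 \<le> F z x" and X_cdf_le_1: "F z x \<le> 1"
    and X_cdf_mono: "x \<le> y \<Longrightarrow> F z x \<le> F z y"
proof -
  obtain N where N: "real_distribution N" "F z = cdf N" using assms by (rule X_cdfD)
  interpret real_distribution N by fact
  show "continuous (at_right x) (F z)" "0 \<le> F z x" "F z x \<le> 1" "x \<le> y \<Longrightarrow> F z x \<le> F z y"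
    by (auto simp: N cdf_is_right_cont cdf_nonneg cdf_bounded_prob cdf_nondecreasing)
qed

lemma measurable_X_cdf_compose:
  assumes "F \<in> X_cdf M" "y \<in> borel_measurable S"
  shows "(\<lambda>z. F z (y z)) \<in> borel_measurable S"
proof (rule measurable_right_cont_compose[OF _ X_cdf_right_cont[OF assms(1)] assms(2)])
  show "(\<lambda>z. F z x) \<in> borel_measurable S" for x
    using assms(1) unfolding X_cdf_def mem_Collect_eq by blast
qed

text \<open>Given the next pair \<open>z'\<close>, the prepended return is at most \<open>x\<close>
  when the continuation is at most \<open>next_arg\<close>, an event whose probability is the return
  CDF of \<open>z'\<close> at that threshold. Averaging over \<open>K z\<close> gives the operator.
  The computation runs in \<open>ennreal\<close> and returns to the real integral at the
  end.\<close>

lemma return_cdf_fixed_point: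
  assumes conv: "soft_return_converges M \<pi> \<alpha>" and adm: "return_cdf M \<pi> \<alpha> \<in> X_cdf M"
  shows "T_cdf M \<pi> \<alpha> (return_cdf M \<pi> \<alpha>) = return_cdf M \<pi> \<alpha>"
proof -
  let ?F = "return_cdf M \<pi> \<alpha>"
  have em: "emeasure (P z) {\<omega>\<in>space \<Omega>. soft_return M \<pi> \<alpha> \<omega> \<le> x} = ennreal (?F z x)" if z: "z \<in> space S" for z x
  proof -
    interpret P: prob_space "P z" by (rule prob_space_P[OF z])
    have m: "soft_return M \<pi> \<alpha> \<in> borel_measurable (P z)"
      by (simp add: measurable_cong_sets[OF sets_P[OF z] refl])
    have "?F z x = measure (P z) {\<omega>\<in>space \<Omega>. soft_return M \<pi> \<alpha> \<omega> \<le> x}"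
      using z by (auto simp: return_cdf_def cdf_def return_law_def measure_distr[OF m] space_P[OF z] intro!: arg_cong[where f="measure _"])
    then show ?thesis by (simp add: P.emeasure_eq_measure)
  qed
  have "T_cdf M \<pi> \<alpha> ?F z x = ?F z x" if z: "z \<in> space S" for z x
  proof -
    interpret K: prob_space "K z" by (rule prob_space_K[OF z])
    have [measurable]: "(\<lambda>z'. ?F z' (next_arg \<alpha> z x z')) \<in> borel_measurable S"
      using z by (intro measurable_X_cdf_compose[OF adm]) measurable
    have meas: "(\<lambda>z'. ?F z' (next_arg \<alpha> z x z')) \<in> borel_measurable (K z)"
      by (simp add: measurable_cong_sets[OF sets_K[OF z] refl])
    have int: "integrable (K z) (\<lambda>z'. ?F z' (next_arg \<alpha> z x z'))"
      using meas by (intro K.integrable_const_bound[where B=1])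
        (auto simp: space_K[OF z] X_cdf_nonneg[OF adm] X_cdf_le_1[OF adm] intro!: AE_I2)
    have "ennreal (?F z x) = (\<integral>\<^sup>+\<omega>. indicator {\<omega>\<in>space \<Omega>. soft_return M \<pi> \<alpha> \<omega> \<le> x} \<omega> \<partial>P z)"
      using z by (subst em[OF z, symmetric], intro nn_integral_indicator[symmetric]) (simp add: sets_P)
    also have "\<dots> = (\<integral>\<^sup>+z'. \<integral>\<^sup>+\<omega>. indicator {\<omega>\<in>space \<Omega>. soft_return M \<pi> \<alpha> \<omega> \<le> x} (case_nat z \<omega>) \<partial>P z' \<partial>K z)"
      by (rule nn_integral_traj_law[OF z]) measurable
    also have "\<dots> = (\<integral>\<^sup>+z'. ennreal (?F z' (next_arg \<alpha> z x z')) \<partial>K z)"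
    proof (intro nn_integral_cong)
      fix z' assume "z' \<in> space (K z)"
      then have z': "z' \<in> space S" by (simp add: space_K[OF z])
      have "AE \<omega> in P z'. summable (\<lambda>k. soft_return_term M \<pi> \<alpha> \<omega> (Suc k))"
        using conv z' by (simp add: soft_return_converges_def)
      moreover have "AE \<omega> in P z'. next_arg \<alpha> z x (\<omega> 0) = next_arg \<alpha> z x z'"
        \<comment> \<open>The threshold is random through \<open>\<omega> 0\<close>; almost surely
          it equals its value at \<open>z'\<close>.\<close>
        by (intro AE_P_initial_eq z' measurable_next_arg z)
      moreover have "AE \<omega> in P z'. \<omega> \<in> space \<Omega>"
        by (rule AE_I2) (simp add: space_P[OF z'])
      ultimately have "AE \<omega> in P z'. indicator {\<omega>\<in>space \<Omega>. soft_return M \<pi> \<alpha> \<omega> \<le> x} (case_nat z \<omega>)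
         = (indicator {\<omega>\<in>space \<Omega>. soft_return M \<pi> \<alpha> \<omega> \<le> next_arg \<alpha> z x z'} \<omega> :: ennreal)"
      proof eventually_elim
        fix \<omega> assume s: "summable (\<lambda>k. soft_return_term M \<pi> \<alpha> \<omega> (Suc k))"
          and n: "next_arg \<alpha> z x (\<omega> 0) = next_arg \<alpha> z x z'" and \<omega>: "\<omega> \<in> space \<Omega>"
        have "soft_return M \<pi> \<alpha> (case_nat z \<omega>) \<le> x \<longleftrightarrow> soft_return M \<pi> \<alpha> \<omega> \<le> next_arg \<alpha> z x z'"
          unfolding n[symmetric] unfolding next_arg_def soft_return_case_nat[OF s]
          using discount_pos by (simp add: field_simps)
        moreover have "case_nat z \<omega> \<in> space \<Omega>"
          by (rule measurable_space[OF measurable_case_nat_traj[OF z] \<omega>])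
        ultimately show "indicator {\<omega>\<in>space \<Omega>. soft_return M \<pi> \<alpha> \<omega> \<le> x} (case_nat z \<omega>)
         = (indicator {\<omega>\<in>space \<Omega>. soft_return M \<pi> \<alpha> \<omega> \<le> next_arg \<alpha> z x z'} \<omega> :: ennreal)"
          using \<omega> by (simp add: indicator_def)
      qed
      then have "(\<integral>\<^sup>+\<omega>. indicator {\<omega>\<in>space \<Omega>. soft_return M \<pi> \<alpha> \<omega> \<le> x} (case_nat z \<omega>) \<partial>P z')
        = (\<integral>\<^sup>+\<omega>. indicator {\<omega>\<in>space \<Omega>. soft_return M \<pi> \<alpha> \<omega> \<le> next_arg \<alpha> z x z'} \<omega> \<partial>P z')"
        by (rule nn_integral_cong_AE)
      also have "\<dots> = ennreal (?F z' (next_arg \<alpha> z x z'))"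
        using z' by (subst em[OF z', symmetric], intro nn_integral_indicator) (simp add: sets_P)
      finally show "(\<integral>\<^sup>+\<omega>. indicator {\<omega>\<in>space \<Omega>. soft_return M \<pi> \<alpha> \<omega> \<le> x} (case_nat z \<omega>) \<partial>P z')
        = ennreal (?F z' (next_arg \<alpha> z x z'))" .
    qed
    also have "\<dots> = ennreal (\<integral>z'. ?F z' (next_arg \<alpha> z x z') \<partial>K z)"
      by (rule nn_integral_eq_integral[OF int]) (auto simp: space_K[OF z] X_cdf_nonneg[OF adm] intro!: AE_I2)
    also have "\<dots> = ennreal (T_cdf M \<pi> \<alpha> ?F z x)"
      by (simp add: T_cdf_eq[OF z])
    finally have "ennreal (?F z x) = ennreal (T_cdf M \<pi> \<alpha> ?F z x)" .
    moreover have "0 \<le> T_cdf M \<pi> \<alpha> ?F z x"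
      unfolding T_cdf_eq[OF z] by (rule integral_nonneg_AE) (auto simp: space_K[OF z] X_cdf_nonneg[OF adm] intro!: AE_I2)
    ultimately show ?thesis
      using X_cdf_nonneg[OF adm z, of x] by simp
  qed
  moreover have "T_cdf M \<pi> \<alpha> ?F z = ?F z" if "z \<notin> space S" for z
    using that by (simp add: T_cdf_def return_cdf_def)
  ultimately have "T_cdf M \<pi> \<alpha> ?F z = ?F z" for z
    by (cases "z \<in> space S") (simp_all add: fun_eq_iff)
  then show ?thesis by (rule ext)
qed

end

section \<open>The Bellman operator on CDF fields\<close>

text \<open>Jensen's inequality for the square is the nonnegativity of the variance;
  \<open>B\<close> secures integrability of \<open>h\<close> and of its square.\<close>

lemma (in prob_space) power2_integral_le:
  fixes h :: "'a \<Rightarrow> real"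
  assumes [measurable]: "h \<in> borel_measurable M" and B: "\<And>x. x \<in> space M \<Longrightarrow> \<bar>h x\<bar> \<le> B"
  shows "ennreal ((\<integral>x. h x \<partial>M)\<^sup>2) \<le> (\<integral>\<^sup>+x. ennreal ((h x)\<^sup>2) \<partial>M)"
proof -
  have i: "integrable M h"
    by (rule integrable_const_bound[where B=B]) (auto intro!: AE_I2 B)
  have i2: "integrable M (\<lambda>x. (h x)\<^sup>2)"
  proof (rule integrable_const_bound[where B="B\<^sup>2"])
    show "AE x in M. norm ((h x)\<^sup>2) \<le> B\<^sup>2"
    proof (rule AE_I2)
      fix x assume "x \<in> space M"
      from power_mono[OF B[OF this], of 2] show "norm ((h x)\<^sup>2) \<le> B\<^sup>2" by simp
    qed
  qed simp
  have "(\<integral>x. h x \<partial>M)\<^sup>2 \<le> (\<integral>x. (h x)\<^sup>2 \<partial>M)"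
    using variance_eq[OF i i2] variance_positive[of h] by simp
  then show ?thesis
    by (subst nn_integral_eq_integral[OF i2]) (auto intro: ennreal_leI)
qed

text \<open>Jensen under \<open>K\<close> at each \<open>x\<close>, then Tonelli to exchange the two
  integrals.\<close>

lemma nn_integral_power2_mixture_le:
  fixes h :: "'a \<Rightarrow> real \<Rightarrow> real"
  assumes K: "prob_space K" and h[measurable]: "(\<lambda>(z, x). h z x) \<in> borel_measurable (K \<Otimes>\<^sub>M lborel)"
    and B: "\<And>z x. z \<in> space K \<Longrightarrow> \<bar>h z x\<bar> \<le> B"
  shows "(\<integral>\<^sup>+x. ennreal ((\<integral>z. h z x \<partial>K)\<^sup>2) \<partial>lborel) \<le> (\<integral>\<^sup>+z. \<integral>\<^sup>+x. ennreal ((h z x)\<^sup>2) \<partial>lborel \<partial>K)"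
proof -
  interpret K: prob_space K by fact
  interpret pair_sigma_finite K lborel ..
  have "(\<integral>\<^sup>+x. ennreal ((\<integral>z. h z x \<partial>K)\<^sup>2) \<partial>lborel) \<le> (\<integral>\<^sup>+x. \<integral>\<^sup>+z. ennreal ((h z x)\<^sup>2) \<partial>K \<partial>lborel)"
    by (intro nn_integral_mono K.power2_integral_le[where B=B] B) measurable
  also have "\<dots> = (\<integral>\<^sup>+z. \<integral>\<^sup>+x. ennreal ((h z x)\<^sup>2) \<partial>lborel \<partial>K)"
    by (rule Fubini') measurable
  finally show ?thesis .
qed

text \<open>The Jacobian \<open>c\<close>, used with the discount factor, is where the contraction
  constant comes from; the translation \<open>t\<close> leaves no trace.\<close>

lemma nn_integral_rescale:
  fixes g :: "real \<Rightarrow> ennreal"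
  assumes [measurable]: "g \<in> borel_measurable borel" and c: "c > 0"
  shows "(\<integral>\<^sup>+x. g ((x - t) / c) \<partial>lborel) = ennreal c * (\<integral>\<^sup>+x. g x \<partial>lborel)"
  using c by (subst nn_integral_real_affine[of _ c t]) auto

text \<open>Division by \<open>c > 0\<close> keeps signs, so the two steps differ only between 0 and
  \<open>t\<close>, and there by 1.\<close>

lemma nn_integral_indicator_shift_le:
  assumes c: "c > 0"
  shows "(\<integral>\<^sup>+x. ennreal ((indicator {0..} ((x - t) / c) - indicator {0..} x)\<^sup>2) \<partial>lborel) \<le> ennreal \<bar>t\<bar>"
proof -
  have "(\<integral>\<^sup>+x. ennreal ((indicator {0..} ((x - t) / c) - indicator {0..} x)\<^sup>2) \<partial>lborel)
     \<le> (\<integral>\<^sup>+x. indicator {min 0 t..max 0 t} x \<partial>lborel)"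
    using c by (intro nn_integral_mono) (auto simp: indicator_def zero_le_divide_iff)
  also have "\<dots> = ennreal \<bar>t\<bar>"
    by (simp add: min_def max_def)
  finally show ?thesis .
qed

lemma ennreal_power2_add_le:
  "ennreal ((a + b)\<^sup>2) \<le> 2 * ennreal (a\<^sup>2) + 2 * ennreal (b\<^sup>2)"
proof -
  have "(a + b)\<^sup>2 \<le> 2 * a\<^sup>2 + 2 * b\<^sup>2"
    using power2_norm_add_le[of a b] by simp
  from ennreal_leI[OF this] show ?thesis by (simp add: ennreal_mult)
qed

lemma ennreal_affine_less_infinity:
  "a < \<infinity> \<Longrightarrow> b < \<infinity> \<Longrightarrow> 2 * (ennreal c * a) + 2 * b < \<infinity>"
  by (simp add: ennreal_mult_less_top)

text \<open>A supremum of squared norms: contraction holds for it with factor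
  \<open>discount M\<close>, and a root is taken only once, through
  \<open>d_Cr_le_sqrt_l2_dist\<close>.\<close>

definition l2_dist :: "('s, 'a) mdp \<Rightarrow> ('s \<times> 'a \<Rightarrow> real \<Rightarrow> real) \<Rightarrow> ('s \<times> 'a \<Rightarrow> real \<Rightarrow> real) \<Rightarrow> ennreal" where
  "l2_dist M F G = (\<Squnion>z\<in>space (sa_space M). \<integral>\<^sup>+x. ennreal ((F z x - G z x)\<^sup>2) \<partial>lborel)"

lemma mono_sqrt_ennreal: "a \<le> b \<Longrightarrow> sqrt_ennreal a \<le> sqrt_ennreal b"
  by (auto simp: sqrt_ennreal_def top_unique less_top intro!: ennreal_leI enn2real_mono)

lemma d_Cr_le_sqrt_l2_dist: "d_Cr M F G \<le> sqrt_ennreal (l2_dist M F G)"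
  unfolding d_Cr_def l2_dist_def by (intro SUP_least mono_sqrt_ennreal SUP_upper)

section \<open>Invariance of the CDF fields and contraction\<close>

context policy_mdp
begin

abbreviation "\<gamma> \<equiv> discount M"

text \<open>The translation in the distributional reading of the operator: a step from
  \<open>z\<close> to \<open>z'\<close> replaces a return \<open>Y\<close> by
  \<open>shift \<alpha> z z' + \<gamma> * Y\<close>. Its absolute value is the integrand of the
  first-moment hypothesis.\<close>

definition shift :: "real \<Rightarrow> 's \<times> 'a \<Rightarrow> 's \<times> 'a \<Rightarrow> real" where
  "shift \<alpha> z z' = reward M (fst z) (snd z) (fst z') - \<gamma> * \<alpha> * ln (pdens \<pi> (fst z') (snd z'))"

lemma next_arg_eq: "next_arg \<alpha> z x z' = (x - shift \<alpha> z z') / \<gamma>"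
  using discount_pos by (simp add: next_arg_def shift_def field_simps)

lemma measurable_shift[measurable]: "z \<in> space S \<Longrightarrow> shift \<alpha> z \<in> borel_measurable S"
  unfolding shift_def[abs_def] by measurable

lemma X_cdf_measurable:
  assumes "F \<in> X_cdf M" "z \<in> space S"
  shows "F z \<in> borel_measurable borel"
  by (rule borel_measurable_mono) (auto intro!: monoI X_cdf_mono[OF assms])

text \<open>Tonelli requires measurability in both variables at once, whereas \<open>X_cdf\<close>
  grants it in \<open>z'\<close> at each fixed argument; right continuity of the CDFs bridges the
  gap.\<close>

lemma measurable_next_cdf:
  assumes F: "F \<in> X_cdf M" and z: "z \<in> space S"
  shows "(\<lambda>(z', x). F z' (next_arg \<alpha> z x z')) \<in> borel_measurable (K z \<Otimes>\<^sub>M lborel)"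
proof -
  have "(\<lambda>p. F (fst p) (next_arg \<alpha> z (snd p) (fst p))) \<in> borel_measurable (S \<Otimes>\<^sub>M lborel)"
  proof (rule measurable_right_cont_compose[where F="\<lambda>p. F (fst p)" and y="\<lambda>p. next_arg \<alpha> z (snd p) (fst p)"])
    have "(\<lambda>z. F z x) \<in> borel_measurable S" for x
      using F unfolding X_cdf_def mem_Collect_eq by blast
    then show "(\<lambda>p. F (fst p) x) \<in> borel_measurable (S \<Otimes>\<^sub>M lborel)" for x
      by (rule measurable_compose[OF measurable_fst])
    show "continuous (at_right x) (F (fst p))" if "p \<in> space (S \<Otimes>\<^sub>M lborel)" for p x
      using that by (intro X_cdf_right_cont[OF F]) (auto simp: space_pair_measure)
    have [measurable]: "shift \<alpha> z \<in> borel_measurable S" using z by measurable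
    show "(\<lambda>p. next_arg \<alpha> z (snd p) (fst p)) \<in> borel_measurable (S \<Otimes>\<^sub>M lborel)"
      unfolding next_arg_eq by measurable
  qed
  moreover have eq: "sets (K z \<Otimes>\<^sub>M lborel) = sets (S \<Otimes>\<^sub>M lborel)"
    by (intro sets_pair_measure_cong sets_K[OF z] refl)
  ultimately show ?thesis
    unfolding measurable_cong_sets[OF eq refl] by (simp add: case_prod_beta')
qed

lemma integrable_next_cdf:
  assumes F: "F \<in> X_cdf M" and z: "z \<in> space S"
  shows "integrable (K z) (\<lambda>z'. F z' (next_arg \<alpha> z x z'))"
proof -
  interpret K: prob_space "K z" by (rule prob_space_K[OF z])
  have "(\<lambda>z'. F z' (next_arg \<alpha> z x z')) \<in> borel_measurable S"
    using z by (intro measurable_X_cdf_compose[OF F]) measurable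
  then have "(\<lambda>z'. F z' (next_arg \<alpha> z x z')) \<in> borel_measurable (K z)"
    by (simp add: measurable_cong_sets[OF sets_K[OF z] refl])
  then show ?thesis
    by (intro K.integrable_const_bound[where B=1])
       (auto simp: space_K[OF z] X_cdf_nonneg[OF F] X_cdf_le_1[OF F] intro!: AE_I2)
qed

lemma next_arg_mono: "x \<le> y \<Longrightarrow> next_arg \<alpha> z x z' \<le> next_arg \<alpha> z y z'"
  unfolding next_arg_eq using discount_pos by (intro divide_right_mono) auto

text \<open>Dominated convergence under \<open>K z\<close> with the constant bound 1. The arbitrary
  limit \<open>g\<close> lets it serve right continuity and both limits at infinity.\<close>

lemma T_cdf_tendsto:
  assumes F: "F \<in> X_cdf M" and z: "z \<in> space S" and g: "g \<in> borel_measurable S"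
    and lim: "\<And>z'. z' \<in> space S \<Longrightarrow> (\<lambda>n. F z' (next_arg \<alpha> z (X n) z')) \<longlonglongrightarrow> g z'"
  shows "(\<lambda>n. T_cdf M \<pi> \<alpha> F z (X n)) \<longlonglongrightarrow> (\<integral>z'. g z' \<partial>K z)"
  unfolding T_cdf_eq[OF z]
proof (rule integral_dominated_convergence[where w="\<lambda>_. 1"])
  interpret K: prob_space "K z" by (rule prob_space_K[OF z])
  show "integrable (K z) (\<lambda>_. 1::real)" by simp
  show "g \<in> borel_measurable (K z)" using g by (simp add: measurable_cong_sets[OF sets_K[OF z] refl])
  show "(\<lambda>z'. F z' (next_arg \<alpha> z (X n) z')) \<in> borel_measurable (K z)" for n
    using integrable_next_cdf[OF F z] by (rule borel_measurable_integrable)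
  show "AE z' in K z. (\<lambda>n. F z' (next_arg \<alpha> z (X n) z')) \<longlonglongrightarrow> g z'"
    by (rule AE_I2) (simp add: lim space_K[OF z])
  show "AE z' in K z. norm (F z' (next_arg \<alpha> z (X n) z')) \<le> 1" for n
    by (rule AE_I2) (simp add: space_K[OF z] X_cdf_nonneg[OF F] X_cdf_le_1[OF F])
qed

text \<open>\<open>Gamma_F\<close> asks for a distribution behind each field value.
  \<open>interval_measure\<close> supplies it from monotonicity, right continuity and the limits 0
  and 1, each inherited from the CDFs under the integral.\<close>

lemma T_cdf_is_cdf:
  assumes F: "F \<in> X_cdf M" and z: "z \<in> space S"
  shows "real_distribution (interval_measure (T_cdf M \<pi> \<alpha> F z))"
    and "cdf (interval_measure (T_cdf M \<pi> \<alpha> F z)) = T_cdf M \<pi> \<alpha> F z"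
proof -
  interpret K: prob_space "K z" by (rule prob_space_K[OF z])
  let ?T = "T_cdf M \<pi> \<alpha> F z"
  have mono: "?T x \<le> ?T y" if "x \<le> y" for x y
    unfolding T_cdf_eq[OF z] using that
    by (intro integral_mono integrable_next_cdf[OF F z] X_cdf_mono[OF F] next_arg_mono) (auto simp: space_K[OF z])
  have right: "continuous (at_right a) ?T" for a
    unfolding continuous_within
  proof (rule tendsto_at_right_sequentially[where b="a + 1"])
    fix X :: "nat \<Rightarrow> real" assume X: "\<And>n. a < X n" "X \<longlonglongrightarrow> a"
    have "(\<lambda>n. ?T (X n)) \<longlonglongrightarrow> (\<integral>z'. F z' (next_arg \<alpha> z a z') \<partial>K z)"
    proof (rule T_cdf_tendsto[OF F z])
      show "(\<lambda>z'. F z' (next_arg \<alpha> z a z')) \<in> borel_measurable S"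
        using z by (intro measurable_X_cdf_compose[OF F]) measurable
      fix z' assume z': "z' \<in> space S"
      have "(\<lambda>n. next_arg \<alpha> z (X n) z') \<longlonglongrightarrow> next_arg \<alpha> z a z'"
        unfolding next_arg_eq using discount_pos by (intro tendsto_intros X) auto
      \<comment> \<open>Strict monotonicity of \<open>next_arg\<close> in \<open>x\<close> makes the
        arguments approach from the right, the only side on which \<open>F z'\<close> is known to be
        continuous.\<close>
      moreover have "next_arg \<alpha> z a z' < next_arg \<alpha> z (X n) z'" for n
        unfolding next_arg_eq using discount_pos X(1)[of n] by (intro divide_strict_right_mono) auto
      ultimately have "filterlim (\<lambda>n. next_arg \<alpha> z (X n) z') (at_right (next_arg \<alpha> z a z')) sequentially"
        unfolding filterlim_at by (auto intro!: always_eventually simp: less_imp_neq[symmetric])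
      with X_cdf_right_cont[OF F z', of "next_arg \<alpha> z a z'"]
      show "(\<lambda>n. F z' (next_arg \<alpha> z (X n) z')) \<longlonglongrightarrow> F z' (next_arg \<alpha> z a z')"
        unfolding continuous_within by (rule filterlim_compose)
    qed
    then show "(\<lambda>n. ?T (X n)) \<longlonglongrightarrow> ?T a"
      by (simp add: T_cdf_eq[OF z])
  qed simp
  have top: "(?T \<longlongrightarrow> 1) at_top"
  proof (rule tendsto_at_topI_sequentially)
    fix X :: "nat \<Rightarrow> real" assume X: "filterlim X at_top sequentially"
    have "(\<lambda>n. ?T (X n)) \<longlonglongrightarrow> (\<integral>z'. 1 \<partial>K z)"
    proof (rule T_cdf_tendsto[OF F z])
      fix z' assume z': "z' \<in> space S"
      obtain N where N: "real_distribution N" "F z' = cdf N" using F z' by (rule X_cdfD)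
      have "filterlim (\<lambda>x. next_arg \<alpha> z x z') at_top at_top"
        unfolding filterlim_at_top
      proof
        fix Z show "\<forall>\<^sub>F x in at_top. Z \<le> next_arg \<alpha> z x z'"
          using eventually_ge_at_top[of "Z * \<gamma> + shift \<alpha> z z'"]
          by eventually_elim (use discount_pos in \<open>simp add: next_arg_eq pos_le_divide_eq\<close>)
      qed
      from filterlim_compose[OF this X]
      have "filterlim (\<lambda>n. next_arg \<alpha> z (X n) z') at_top sequentially" .
      from filterlim_compose[OF real_distribution.cdf_lim_at_top_prob[OF N(1)] this]
      show "(\<lambda>n. F z' (next_arg \<alpha> z (X n) z')) \<longlonglongrightarrow> 1" by (simp add: N)
    qed simp
    then show "(\<lambda>n. ?T (X n)) \<longlonglongrightarrow> 1" using K.prob_space by simp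
  qed
  have bot: "(?T \<longlongrightarrow> 0) at_bot"
    unfolding filterlim_at_bot_mirror
  proof (rule tendsto_at_topI_sequentially)
    fix X :: "nat \<Rightarrow> real" assume X: "filterlim X at_top sequentially"
    have "(\<lambda>n. ?T (- X n)) \<longlonglongrightarrow> (\<integral>z'. 0 \<partial>K z)"
    proof (rule T_cdf_tendsto[OF F z])
      fix z' assume z': "z' \<in> space S"
      obtain N where N: "real_distribution N" "F z' = cdf N" using F z' by (rule X_cdfD)
      have "filterlim (\<lambda>x. next_arg \<alpha> z (- x) z') at_bot at_top"
        unfolding filterlim_at_bot
      proof
        fix Z show "\<forall>\<^sub>F x in at_top. next_arg \<alpha> z (- x) z' \<le> Z"
          using eventually_ge_at_top[of "- (Z * \<gamma> + shift \<alpha> z z')"]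
          by eventually_elim (use discount_pos in \<open>simp add: next_arg_eq pos_divide_le_eq\<close>)
      qed
      from filterlim_compose[OF this X]
      have "filterlim (\<lambda>n. next_arg \<alpha> z (- X n) z') at_bot sequentially" .
      from filterlim_compose[OF finite_borel_measure.cdf_lim_at_bot[OF real_distribution.finite_borel_measure_M[OF N(1)]] this]
      show "(\<lambda>n. F z' (next_arg \<alpha> z (- X n) z')) \<longlonglongrightarrow> 0" by (simp add: N)
    qed simp
    then show "(\<lambda>n. ?T (- X n)) \<longlonglongrightarrow> 0" by simp
  qed
  show "real_distribution (interval_measure ?T)"
    using mono right bot top by (rule real_distribution_interval_measure)
  show "cdf (interval_measure ?T) = ?T"
    using mono right bot by (rule cdf_interval_measure)
qed

text \<open>At each \<open>z\<close> the difference of the images is an average over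
  \<open>z'\<close> of rescaled differences. Jensen moves the average outside the square, and
  rescaling produces \<open>\<gamma>\<close> whatever the value of \<open>shift\<close>.\<close>

lemma T_cdf_contraction:
  assumes F: "F \<in> X_cdf M" and G: "G \<in> X_cdf M"
  shows "l2_dist M (T_cdf M \<pi> \<alpha> F) (T_cdf M \<pi> \<alpha> G) \<le> ennreal \<gamma> * l2_dist M F G"
  unfolding l2_dist_def[of M "T_cdf M \<pi> \<alpha> F"]
proof (rule SUP_least)
  fix z assume z: "z \<in> space S"
  interpret K: prob_space "K z" by (rule prob_space_K[OF z])
  let ?h = "\<lambda>z' x. F z' (next_arg \<alpha> z x z') - G z' (next_arg \<alpha> z x z')"
  have "(\<integral>\<^sup>+x. ennreal ((T_cdf M \<pi> \<alpha> F z x - T_cdf M \<pi> \<alpha> G z x)\<^sup>2) \<partial>lborel)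
    = (\<integral>\<^sup>+x. ennreal ((\<integral>z'. ?h z' x \<partial>K z)\<^sup>2) \<partial>lborel)"
    by (simp add: T_cdf_eq[OF z] Bochner_Integration.integral_diff integrable_next_cdf[OF F z] integrable_next_cdf[OF G z])
  also have "\<dots> \<le> (\<integral>\<^sup>+z'. \<integral>\<^sup>+x. ennreal ((?h z' x)\<^sup>2) \<partial>lborel \<partial>K z)"
  proof (rule nn_integral_power2_mixture_le[OF prob_space_K[OF z], where B=1])
    show "(\<lambda>(z', x). ?h z' x) \<in> borel_measurable (K z \<Otimes>\<^sub>M lborel)"
      using borel_measurable_diff[OF measurable_next_cdf[OF F z, of \<alpha>] measurable_next_cdf[OF G z, of \<alpha>]]
      by (simp add: case_prod_beta')
    fix z' x assume "z' \<in> space (K z)"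
    then have z': "z' \<in> space S" by (simp add: space_K[OF z])
    show "\<bar>?h z' x\<bar> \<le> 1"
      using X_cdf_nonneg[OF F z', of "next_arg \<alpha> z x z'"] X_cdf_le_1[OF F z', of "next_arg \<alpha> z x z'"]
        X_cdf_nonneg[OF G z', of "next_arg \<alpha> z x z'"] X_cdf_le_1[OF G z', of "next_arg \<alpha> z x z'"]
      by (simp add: abs_le_iff)
  qed
  also have "\<dots> \<le> (\<integral>\<^sup>+z'. ennreal \<gamma> * l2_dist M F G \<partial>K z)"
  proof (rule nn_integral_mono)
    fix z' assume "z' \<in> space (K z)"
    then have z': "z' \<in> space S" by (simp add: space_K[OF z])
    have [measurable]: "F z' \<in> borel_measurable borel" "G z' \<in> borel_measurable borel"
      using F G z' by (simp_all add: X_cdf_measurable)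
    have "(\<integral>\<^sup>+x. ennreal ((?h z' x)\<^sup>2) \<partial>lborel) = ennreal \<gamma> * (\<integral>\<^sup>+x. ennreal ((F z' x - G z' x)\<^sup>2) \<partial>lborel)"
      unfolding next_arg_eq by (rule nn_integral_rescale[OF _ discount_pos]) measurable
    also have "\<dots> \<le> ennreal \<gamma> * l2_dist M F G"
      unfolding l2_dist_def by (intro mult_left_mono SUP_upper z') auto
    finally show "(\<integral>\<^sup>+x. ennreal ((?h z' x)\<^sup>2) \<partial>lborel) \<le> ennreal \<gamma> * l2_dist M F G" .
  qed
  also have "\<dots> = ennreal \<gamma> * l2_dist M F G"
    by (simp add: K.emeasure_space_1)
  finally show "(\<integral>\<^sup>+x. ennreal ((T_cdf M \<pi> \<alpha> F z x - T_cdf M \<pi> \<alpha> G z x)\<^sup>2) \<partial>lborel) \<le> ennreal \<gamma> * l2_dist M F G" .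
qed

text \<open>The unit step is not rescaled along with \<open>F z'\<close>, so the integrand splits
  into the rescaled centred CDF and a translated step minus the step at 0. The former costs at most
  \<open>\<gamma>\<close> times the uniform bound, the latter at most
  \<open>\<bar>shift \<alpha> z z'\<bar>\<close>; the factors 2 come from squaring a sum.\<close>

lemma nn_integral_centre_T_cdf_le:
  assumes F: "F \<in> X_cdf M" and z: "z \<in> space S"
  shows "(\<integral>\<^sup>+x. ennreal ((centre (T_cdf M \<pi> \<alpha> F z) x)\<^sup>2) \<partial>lborel)
    \<le> 2 * (ennreal \<gamma> * (\<Squnion>z\<in>space S. \<integral>\<^sup>+x. ennreal ((centre (F z) x)\<^sup>2) \<partial>lborel))
      + 2 * (\<integral>\<^sup>+z'. ennreal \<bar>shift \<alpha> z z'\<bar> \<partial>K z)" (is "_ \<le> 2 * (_ * ?C) + _")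
proof -
  interpret K: prob_space "K z" by (rule prob_space_K[OF z])
  have [measurable]: "shift \<alpha> z \<in> borel_measurable (K z)"
    using measurable_shift[OF z] by (simp add: measurable_cong_sets[OF sets_K[OF z] refl])
  let ?h = "\<lambda>z' x. F z' (next_arg \<alpha> z x z') - indicator {0..} x"
  have "centre (T_cdf M \<pi> \<alpha> F z) x = (\<integral>z'. ?h z' x \<partial>K z)" for x
    using K.prob_space
    by (simp add: centre_def T_cdf_eq[OF z] Bochner_Integration.integral_diff integrable_next_cdf[OF F z])
  then have "(\<integral>\<^sup>+x. ennreal ((centre (T_cdf M \<pi> \<alpha> F z) x)\<^sup>2) \<partial>lborel) = (\<integral>\<^sup>+x. ennreal ((\<integral>z'. ?h z' x \<partial>K z)\<^sup>2) \<partial>lborel)"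
    by simp
  also have "\<dots> \<le> (\<integral>\<^sup>+z'. \<integral>\<^sup>+x. ennreal ((?h z' x)\<^sup>2) \<partial>lborel \<partial>K z)"
  proof (rule nn_integral_power2_mixture_le[OF prob_space_K[OF z], where B=1])
    have "(\<lambda>p. indicator {0..} (snd p :: real) :: real) \<in> borel_measurable (K z \<Otimes>\<^sub>M lborel)"
      by (rule measurable_compose[OF measurable_snd borel_measurable_indicator]) simp
    from borel_measurable_diff[OF measurable_next_cdf[OF F z, of \<alpha>] this]
    show "(\<lambda>(z', x). ?h z' x) \<in> borel_measurable (K z \<Otimes>\<^sub>M lborel)"
      by (simp add: case_prod_beta')
    fix z' x assume "z' \<in> space (K z)"
    then have z': "z' \<in> space S" by (simp add: space_K[OF z])
    show "\<bar>?h z' x\<bar> \<le> 1"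
      using X_cdf_nonneg[OF F z', of "next_arg \<alpha> z x z'"] X_cdf_le_1[OF F z', of "next_arg \<alpha> z x z'"]
      by (simp add: abs_le_iff indicator_def)
  qed
  also have "\<dots> \<le> (\<integral>\<^sup>+z'. 2 * (ennreal \<gamma> * ?C) + 2 * ennreal \<bar>shift \<alpha> z z'\<bar> \<partial>K z)"
  proof (rule nn_integral_mono)
    fix z' assume "z' \<in> space (K z)"
    then have z': "z' \<in> space S" by (simp add: space_K[OF z])
    have [measurable]: "F z' \<in> borel_measurable borel"
      using F z' by (rule X_cdf_measurable)
    have [measurable]: "centre (F z') \<in> borel_measurable borel"
      unfolding centre_def[abs_def] by measurable
    let ?i = "\<lambda>x. indicator {0..} ((x - shift \<alpha> z z') / \<gamma>) - indicator {0..} x :: real"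
    have "(\<integral>\<^sup>+x. ennreal ((?h z' x)\<^sup>2) \<partial>lborel)
      \<le> (\<integral>\<^sup>+x. 2 * ennreal ((centre (F z') ((x - shift \<alpha> z z') / \<gamma>))\<^sup>2) + 2 * ennreal ((?i x)\<^sup>2) \<partial>lborel)"
    proof (rule nn_integral_mono)
      fix x
      have "?h z' x = centre (F z') ((x - shift \<alpha> z z') / \<gamma>) + ?i x"
        by (simp add: centre_def next_arg_eq)
      then show "ennreal ((?h z' x)\<^sup>2) \<le> 2 * ennreal ((centre (F z') ((x - shift \<alpha> z z') / \<gamma>))\<^sup>2) + 2 * ennreal ((?i x)\<^sup>2)"
        by (simp only: ennreal_power2_add_le)
    qed
    also have "\<dots> = 2 * (\<integral>\<^sup>+x. ennreal ((centre (F z') ((x - shift \<alpha> z z') / \<gamma>))\<^sup>2) \<partial>lborel) + 2 * (\<integral>\<^sup>+x. ennreal ((?i x)\<^sup>2) \<partial>lborel)"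
      by (simp add: nn_integral_add nn_integral_cmult)
    also have "(\<integral>\<^sup>+x. ennreal ((centre (F z') ((x - shift \<alpha> z z') / \<gamma>))\<^sup>2) \<partial>lborel) = ennreal \<gamma> * (\<integral>\<^sup>+x. ennreal ((centre (F z') x)\<^sup>2) \<partial>lborel)"
      by (rule nn_integral_rescale[OF _ discount_pos]) measurable
    also have "2 * (ennreal \<gamma> * (\<integral>\<^sup>+x. ennreal ((centre (F z') x)\<^sup>2) \<partial>lborel)) + 2 * (\<integral>\<^sup>+x. ennreal ((?i x)\<^sup>2) \<partial>lborel)
      \<le> 2 * (ennreal \<gamma> * ?C) + 2 * ennreal \<bar>shift \<alpha> z z'\<bar>"
      by (intro add_mono mult_left_mono SUP_upper z' nn_integral_indicator_shift_le discount_pos) auto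
    finally show "(\<integral>\<^sup>+x. ennreal ((?h z' x)\<^sup>2) \<partial>lborel) \<le> 2 * (ennreal \<gamma> * ?C) + 2 * ennreal \<bar>shift \<alpha> z z'\<bar>" .
  qed
  also have "\<dots> = 2 * (ennreal \<gamma> * ?C) + 2 * (\<integral>\<^sup>+z'. ennreal \<bar>shift \<alpha> z z'\<bar> \<partial>K z)"
    by (simp add: nn_integral_add nn_integral_cmult K.emeasure_space_1)
  finally show ?thesis .
qed

text \<open>One estimate yields both finiteness at each \<open>z\<close> and the uniform bound,
  because the suprema \<open>?C\<close> and \<open>?m\<close> do not depend on
  \<open>z\<close>.\<close>

lemma T_cdf_in_X_cdf:
  assumes F: "F \<in> X_cdf M"
    and first_moment: "(\<Squnion>z\<in>space S. \<integral>\<^sup>+z'. ennreal \<bar>shift \<alpha> z z'\<bar> \<partial>K z) < \<infinity>" (is "?m < _")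
    and meas: "\<And>x. (\<lambda>z. T_cdf M \<pi> \<alpha> F z x) \<in> borel_measurable S"
  shows "T_cdf M \<pi> \<alpha> F \<in> X_cdf M"
proof -
  let ?C = "\<Squnion>z\<in>space S. \<integral>\<^sup>+x. ennreal ((centre (F z) x)\<^sup>2) \<partial>lborel"
  have "?C < \<infinity>" using F unfolding X_cdf_def mem_Collect_eq by blast
  with first_moment have fin: "2 * (ennreal \<gamma> * ?C) + 2 * ?m < \<infinity>"
    by (intro ennreal_affine_less_infinity)
  have le: "(\<integral>\<^sup>+x. ennreal ((centre (T_cdf M \<pi> \<alpha> F z) x)\<^sup>2) \<partial>lborel) \<le> 2 * (ennreal \<gamma> * ?C) + 2 * ?m" if z: "z \<in> space S" for z
    by (rule order_trans[OF nn_integral_centre_T_cdf_le[OF F z]])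
       (rule add_left_mono[OF mult_left_mono[OF SUP_upper[OF z] zero_le]])
  have "T_cdf M \<pi> \<alpha> F z \<in> Gamma_F" if z: "z \<in> space S" for z
    unfolding Gamma_F_def mem_Collect_eq
    using T_cdf_is_cdf(1)[OF F z] T_cdf_is_cdf(2)[OF F z, symmetric] le_less_trans[OF le[OF z] fin] by blast
  moreover have "T_cdf M \<pi> \<alpha> F \<in> extensional (space S)"
    unfolding T_cdf_def by (rule restrict_extensional)
  moreover have "(\<Squnion>z\<in>space S. \<integral>\<^sup>+x. ennreal ((centre (T_cdf M \<pi> \<alpha> F z) x)\<^sup>2) \<partial>lborel) < \<infinity>"
    by (rule le_less_trans[OF SUP_least fin]) (rule le)
  ultimately show ?thesis
    using meas unfolding X_cdf_def PiE_iff by blast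
qed

text \<open>The common unit step cancels in \<open>F z x - G z x\<close>, which leaves a difference
  of centred CDFs. Finiteness is what makes \<open>d \<le> \<gamma> * d\<close> conclusive
  later.\<close>

lemma l2_dist_finite:
  assumes F: "F \<in> X_cdf M" and G: "G \<in> X_cdf M"
  shows "l2_dist M F G < \<infinity>"
proof -
  let ?C = "\<lambda>F. \<Squnion>z\<in>space S. \<integral>\<^sup>+x. ennreal ((centre (F z) x)\<^sup>2) \<partial>lborel"
  have "l2_dist M F G \<le> 2 * ?C F + 2 * ?C G"
    unfolding l2_dist_def
  proof (rule SUP_least)
    fix z assume z: "z \<in> space S"
    have [measurable]: "F z \<in> borel_measurable borel" "G z \<in> borel_measurable borel"
      using F G z by (simp_all add: X_cdf_measurable)
    have [measurable]: "centre (F z) \<in> borel_measurable borel" "centre (G z) \<in> borel_measurable borel"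
      unfolding centre_def[abs_def] by measurable
    have "(\<integral>\<^sup>+x. ennreal ((F z x - G z x)\<^sup>2) \<partial>lborel) \<le> (\<integral>\<^sup>+x. 2 * ennreal ((centre (F z) x)\<^sup>2) + 2 * ennreal ((centre (G z) x)\<^sup>2) \<partial>lborel)"
    proof (rule nn_integral_mono)
      fix x
      show "ennreal ((F z x - G z x)\<^sup>2) \<le> 2 * ennreal ((centre (F z) x)\<^sup>2) + 2 * ennreal ((centre (G z) x)\<^sup>2)"
        using ennreal_power2_add_le[of "centre (F z) x" "- centre (G z) x"] by (simp add: centre_def power2_commute[of "G z x"])
    qed
    also have "\<dots> = 2 * (\<integral>\<^sup>+x. ennreal ((centre (F z) x)\<^sup>2) \<partial>lborel) + 2 * (\<integral>\<^sup>+x. ennreal ((centre (G z) x)\<^sup>2) \<partial>lborel)"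
      by (simp add: nn_integral_add nn_integral_cmult)
    also have "\<dots> \<le> 2 * ?C F + 2 * ?C G"
      by (intro add_mono mult_left_mono SUP_upper z) auto
    finally show "(\<integral>\<^sup>+x. ennreal ((F z x - G z x)\<^sup>2) \<partial>lborel) \<le> 2 * ?C F + 2 * ?C G" .
  qed
  moreover have "?C F < \<infinity>" "?C G < \<infinity>"
    using F G unfolding X_cdf_def mem_Collect_eq by blast+
  then have "2 * ?C F + 2 * ?C G < \<infinity>"
    using ennreal_affine_less_infinity[of "?C F" "?C G" 1] by simp
  ultimately show ?thesis by (rule le_less_trans)
qed

section \<open>Uniqueness of the fixed point and convergence of the iterates\<close>

lemma X_cdf_eqI:
  assumes F: "F \<in> X_cdf M" and G: "G \<in> X_cdf M" and 0: "l2_dist M F G = 0"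
  shows "F = G"
proof (rule PiE_ext)
  show "F \<in> space S \<rightarrow>\<^sub>E Gamma_F" "G \<in> space S \<rightarrow>\<^sub>E Gamma_F"
    using F G by (simp_all add: X_cdf_def)
  fix z assume z: "z \<in> space S"
  have [measurable]: "F z \<in> borel_measurable borel" "G z \<in> borel_measurable borel"
    using F G z by (simp_all add: X_cdf_measurable)
  have "(\<integral>\<^sup>+x. ennreal ((F z x - G z x)\<^sup>2) \<partial>lborel) \<le> 0"
    unfolding 0[symmetric] l2_dist_def by (rule SUP_upper[OF z])
  then have "AE x in lborel. F z x = G z x"
    by (simp add: nn_integral_0_iff_AE ennreal_eq_0_iff)
  then show "F z = G z"
    by (rule right_cont_AE_eq) (auto intro: X_cdf_right_cont F G z)
qed

lemma T_cdf_fixed_point_unique: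
  assumes F: "F \<in> X_cdf M" "T_cdf M \<pi> \<alpha> F = F" and G: "G \<in> X_cdf M" "T_cdf M \<pi> \<alpha> G = G"
  shows "F = G"
proof (rule X_cdf_eqI[OF F(1) G(1)])
  obtain d where d: "l2_dist M F G = ennreal d" "d \<ge> 0"
    using l2_dist_finite[OF F(1) G(1)] by (cases "l2_dist M F G") auto
  have "ennreal d \<le> ennreal \<gamma> * ennreal d"
    using T_cdf_contraction[OF F(1) G(1), of \<alpha>] by (simp add: F(2) G(2) d)
  also have "\<dots> = ennreal (\<gamma> * d)"
    using discount_pos d by (simp add: ennreal_mult)
  finally have "d \<le> \<gamma> * d"
    using d discount_pos by (simp add: ennreal_le_iff)
  then have "(1 - \<gamma>) * d \<le> 0" by (simp add: algebra_simps)
  then show "l2_dist M F G = 0"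
    using d discount_less_1 by (simp add: mult_le_0_iff)
qed

text \<open>Contraction against the fixed point \<open>G\<close> gives the squared bound
  \<open>\<gamma> ^ k * d\<close>, with \<open>d\<close> the initial squared distance, finite
  because both fields lie in \<open>X_cdf\<close>.\<close>

lemma T_cdf_iterates_converge:
  assumes X: "\<And>k. F k \<in> X_cdf M" and Suc: "\<And>k. F (Suc k) = T_cdf M \<pi> \<alpha> (F k)"
    and G: "G \<in> X_cdf M" "T_cdf M \<pi> \<alpha> G = G"
  shows "(\<lambda>k. d_Cr M (F k) G) \<longlonglongrightarrow> 0"
proof -
  obtain d where d: "l2_dist M (F 0) G = ennreal d" "d \<ge> 0"
    using l2_dist_finite[OF X[of 0] G(1)] by (cases "l2_dist M (F 0) G") auto
  have le: "l2_dist M (F k) G \<le> ennreal (\<gamma> ^ k * d)" for k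
  proof (induction k)
    case (Suc k)
    have "l2_dist M (F (Suc k)) G \<le> ennreal \<gamma> * l2_dist M (F k) G"
      using T_cdf_contraction[OF X G(1), of \<alpha>] by (simp add: assms(2) G(2))
    also have "\<dots> \<le> ennreal \<gamma> * ennreal (\<gamma> ^ k * d)"
      by (intro mult_left_mono Suc) auto
    also have "\<dots> = ennreal (\<gamma> ^ Suc k * d)"
      using discount_pos d by (simp add: ennreal_mult mult.assoc)
    finally show ?case .
  qed (simp add: d)
  have "d_Cr M (F k) G \<le> ennreal (sqrt (\<gamma> ^ k * d))" for k
    using order_trans[OF d_Cr_le_sqrt_l2_dist mono_sqrt_ennreal[OF le]] discount_pos d
    by (simp add: sqrt_ennreal_def)
  moreover have "(\<lambda>k. ennreal (sqrt (\<gamma> ^ k * d))) \<longlonglongrightarrow> ennreal (sqrt (0 * d))"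
    using discount_pos discount_less_1 by (intro tendsto_intros LIMSEQ_power_zero) auto
  ultimately show ?thesis
    by (auto intro: tendsto_sandwich[where f="\<lambda>_. 0" and h="\<lambda>k. ennreal (sqrt (\<gamma> ^ k * d))"])
qed

end

text \<open>The conclusion also records that the return CDF field is the only fixed point and that
  no iterate leaves \<open>X_cdf\<close>. The latter puts every \<open>\<nu> k\<close> into
  \<open>X_adm\<close>, where \<open>T_adm\<close> and \<open>d_adm\<close> have their intended
  meaning.\<close>

theorem corollary15:
  fixes M :: "('s, 'a) mdp" and \<pi> :: "('s, 'a) policy" and \<alpha> \<epsilon> :: real
    and F :: "nat \<Rightarrow> 's \<times> 'a \<Rightarrow> real \<Rightarrow> real"
    and \<nu> :: "nat \<Rightarrow> 's \<times> 'a \<Rightarrow> (real \<Rightarrow> complex) set"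
  assumes "is_discounted_mdp M"
    and "is_stationary_policy M \<pi>"
    and "\<alpha> > 0"
    and "\<epsilon> > 0"
    and "soft_return_converges M \<pi> \<alpha>"
    and log_defined: "\<forall>s\<in>space (states M). AE a in action_dist \<pi> s. 0 < pdens \<pi> s a"
    and first_moment:
      "(\<Squnion>(s, a)\<in>space (sa_space M).
          \<integral>\<^sup>+(s', a'). ennreal \<bar>reward M s a s' - discount M * \<alpha> * ln (pdens \<pi> s' a')\<bar>
            \<partial>sa_kernel M \<pi> (s, a)) < \<infinity>"
    and measurability:
      "\<forall>G\<in>X_cdf M. \<forall>x. (\<lambda>z. T_cdf M \<pi> \<alpha> G z x) \<in> borel_measurable (sa_space M)"
    and return_admissible: "return_cdf M \<pi> \<alpha> \<in> X_cdf M"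
    and F_0: "F 0 \<in> X_cdf M"
    and F_Suc: "\<And>k. F (Suc k) = T_cdf M \<pi> \<alpha> (F k)"
    and \<nu>_def: "\<And>k. \<nu> k = V_field M \<epsilon> (F k)"
  shows "T_cdf M \<pi> \<alpha> (return_cdf M \<pi> \<alpha>) = return_cdf M \<pi> \<alpha> \<and>
    (\<forall>G\<in>X_cdf M. T_cdf M \<pi> \<alpha> G = G \<longrightarrow> G = return_cdf M \<pi> \<alpha>) \<and>
    (\<forall>k. F k \<in> X_cdf M) \<and>
    (\<forall>k. \<nu> (Suc k) = T_adm M \<pi> \<alpha> \<epsilon> (\<nu> k)) \<and>
    (\<lambda>k. d_adm M \<epsilon> (\<nu> k) (V_field M \<epsilon> (return_cdf M \<pi> \<alpha>))) \<longlonglongrightarrow> 0"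
proof -
  interpret policy_mdp M \<pi> by unfold_locales fact+
  have moment: "(\<Squnion>z\<in>space S. \<integral>\<^sup>+z'. ennreal \<bar>shift \<alpha> z z'\<bar> \<partial>K z) < \<infinity>"
    using first_moment by (simp add: shift_def case_prod_beta')
  have X: "F k \<in> X_cdf M" for k
  proof (induction k)
    case (Suc k)
    then show ?case
      unfolding F_Suc by (rule T_cdf_in_X_cdf[OF _ moment measurability[rule_format, OF Suc]])
  qed (rule F_0)
  have fixed: "T_cdf M \<pi> \<alpha> (return_cdf M \<pi> \<alpha>) = return_cdf M \<pi> \<alpha>"
    by (rule return_cdf_fixed_point) fact+
  \<comment> \<open>Injectivity makes \<open>inv_into\<close> a genuine inverse, so conjugation by
    \<open>V_field\<close> cancels and both spectral claims reduce to \<open>T_cdf\<close> and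
    \<open>d_Cr\<close>.\<close>
  have inv: "V_field_inv M \<epsilon> (V_field M \<epsilon> G) = G" if "G \<in> X_cdf M" for G
    unfolding V_field_inv_def by (rule inv_into_f_f[OF V_field_inj_on[OF \<open>\<epsilon> > 0\<close>] that])
  have "\<nu> (Suc k) = T_adm M \<pi> \<alpha> \<epsilon> (\<nu> k)" for k
    using X[of k] by (simp add: \<nu>_def F_Suc T_adm_def X_adm_def inv)
  moreover have "(\<lambda>k. d_adm M \<epsilon> (\<nu> k) (V_field M \<epsilon> (return_cdf M \<pi> \<alpha>))) \<longlonglongrightarrow> 0"
    using T_cdf_iterates_converge[of F, OF X F_Suc return_admissible fixed]
    by (simp add: d_adm_def \<nu>_def inv X return_admissible)
  moreover have "\<forall>G\<in>X_cdf M. T_cdf M \<pi> \<alpha> G = G \<longrightarrow> G = return_cdf M \<pi> \<alpha>"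
    by (intro ballI impI T_cdf_fixed_point_unique[OF _ _ return_admissible fixed])
  ultimately show ?thesis
    using X fixed by (intro conjI allI)
qed

end
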